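(* Let $0<t_0<T$, let $p_2$ be the law on $\mathbb{R}^D$ of $x=A_2z_2+\varepsilon_2$, where $A_2\in\mathbb{R}^{D\times d_2}$ satisfies $A_2^\top A_2=I_{d_2}$, $z_2\sim p_{2,z}$ is a random vector in $\mathbb{R}^{d_2}$ with density $p_{2,z}$, and $\varepsilon_2\sim\mathcal{N}(0,\sigma_2^2I_D)$ is independent of $z_2$, with $\sigma_2>0$. Let $V_1\in\mathbb{R}^{D\times d_1}$ satisfy $V_1^\top V_1=I_{d_1}$, let $r=\min\{d_1,d_2\}$, and let $0\le\theta_1\le\cdots\le\theta_r\le\pi/2$ be the principal angles between $\operatorname{col}(V_1)$ and $\operatorname{col}(A_2)$, i.e. $\sigma_j(V_1^\top A_2)=\cos\theta_j$ for $j=1,\dots,r$, where $\sigma_j(\cdot)$ is the $j$-th largest singular value. With $p_{2,t}$, $p_{2,t}^{\rm LD}$, $\alpha$, $h$, $\widetilde h_2$ as in the context, let $$g_2(y,t):=h(t)\nabla\log p_{2,t}^{\rm LD}(y)+y,$$ and for $X_t\sim p_{2,t}$ and $Y_t:=A_2^\top X_t$ define $$M_{g,2}(t):=\mathbb{E}[g_2(Y_t,t)g_2(Y_t,t)^\top],\qquad \mu_2(t):=\lambda_{\min}(M_{g,2}(t)),$$ where $M_{g,2}(t)$ is assumed to be finite for $t\in[t_0,T]$. Then $$\mathcal{B}_{\rm str}(V_1)\ \ge\ \frac{1}{T-t_0}\int_{t_0}^T\left[\frac{\mu_2(t)}{h^2(t)}\Big(d_2-\sum_{j=1}^r\cos^2\theta_j\Big)+\frac{\sigma_2^4\alpha^4(t)}{h^2(t)\widetilde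 h_2(t)}\Big(D-d_1-d_2+\sum_{j=1}^r\cos^2\theta_j\Big)\right]\mathrm{d}t .$$ Consequently, the same lower bound holds for $\mathcal{B}_{\rm freeze}(V_1)$.
   Context: Forward process: $\alpha(t)=e^{-t/2}$, $h(t)=1-e^{-t}$, and $X_t\mid X_0\sim\mathcal{N}(\alpha(t)X_0,h(t)I_D)$. When $X_0\sim p_2$, $p_{2,t}$ denotes the density of $X_t$. Set $\widetilde h_2(t)=\alpha^2(t)\sigma_2^2+h(t)$, and for $y\in\mathbb{R}^{d_2}$ let $p_{2,t}^{\rm LD}(y)=\int_{\mathbb{R}^{d_2}}\phi_{2,t}(y\mid z)p_{2,z}(z)\,\mathrm{d}z$, where $\phi_{2,t}(\cdot\mid z)$ is the density of $\mathcal{N}(\alpha(t)z,\widetilde h_2(t)I_{d_2})$. Risk: for $s:\mathbb{R}^D\times[t_0,T]\to\mathbb{R}^D$, $$\mathcal{L}_2(s)=\frac{1}{T-t_0}\int_{t_0}^T\mathbb{E}_{X_t\sim p_{2,t}}\|s(X_t,t)-\nabla\log p_{2,t}(X_t)\|_2^2\,\mathrm{d}t.$$ Structural class: $\mathcal{S}_{\rm str}(V_1)$ is the set of all $s_{V_1,f}(x,t)=\frac{1}{h(t)}V_1f(V_1^\top x,t)-\frac{1}{h(t)}x$ with $f:\mathbb{R}^{d_1}\times[t_0,T]\to\mathbb{R}^{d_1}$ measurable, and $\mathcal{B}_{\rm str}(V_1)=\inf_{s\in\mathcal{S}_{\rm str}(V_1)}\mathcal{L}_2(s)$. Frozen ReLU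 class: $\mathcal{S}_{\rm freeze}(V_1)$ is the subset of $\mathcal{S}_{\rm str}(V_1)$ given by those $f=f_\theta$ in $\mathcal{F}_{\rm ReLU}^{(d_1)}(L,M,J,K,\kappa,\gamma,\gamma_t)$ (arbitrary fixed parameters), and $\mathcal{B}_{\rm freeze}(V_1)=\inf_{s\in\mathcal{S}_{\rm freeze}(V_1)}\mathcal{L}_2(s)$. Here $\mathcal{F}_{\rm ReLU}^{(d_1)}(L,M,J,K,\kappa,\gamma,\gamma_t)$ is the set of functions $f(z,t)=W_L\sigma(\cdots\sigma(W_1[z^\top,t]^\top+b_1)\cdots)+b_L$ from $\mathbb{R}^{d_1}\times[0,T]$ to $\mathbb{R}^{d_1}$, $\sigma$ the entrywise ReLU, with width at most $M$, $\sup_{z,t}\|f(z,t)\|_2\le K$, all entries of all $W_i,b_i$ bounded by $\kappa$ in absolute value, $\sum_{i=1}^L(\|W_i\|_0+\|b_i\|_0)\le J$ (number of nonzero entries), $\|f(z_1,t)-f(z_2,t)\|_2\le\gamma\|z_1-z_2\|_2$ for all $t\in[0,T]$, and $\|f(z,t_1)-f(z,t_2)\|_2\le\gamma_t|t_1-t_2|$ for all $z$. *)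

theory Defs
  imports "HOL-Probability.Probability" "HOL-Computational_Algebra.Computational_Algebra"
begin

text \<open>The library has the relation \<open>GDERIV\<close> but no gradient function.\<close>

definition gradient :: "('a::real_inner \<Rightarrow> real) \<Rightarrow> 'a \<Rightarrow> 'a" where
  "gradient f x = (THE D. GDERIV f x :> D)"

definition charpoly :: "real^'n^'n \<Rightarrow> real poly" where
  "charpoly S = det (mat [:0, 1:] - map_matrix (\<lambda>a. [:a:]) S)"

text \<open>The real eigenvalues, with algebraic multiplicity. It is only used for symmetric
  matrices, where these are all the eigenvalues.\<close>

definition eigenvalues :: "real^'n^'n \<Rightarrow> real multiset" where
  "eigenvalues S = proots (charpoly S)"

definition lambda_min :: "real^'n^'n \<Rightarrow> real" where
  "lambda_min S = Min (set_mset (eigenvalues S))"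

text \<open>The \<open>j\<close>-th largest singular value of an \<open>m \<times> n\<close> matrix, meant for
  \<open>1 \<le> j \<le> min m n\<close>. The list below has length \<open>n\<close>; if \<open>n > m\<close>, its last \<open>n - m\<close>
  entries are zeros that do not belong to the \<open>min m n\<close> singular values.\<close>

definition singular_value :: "real^'n^'m \<Rightarrow> nat \<Rightarrow> real" where
  "singular_value B j =
     rev (sorted_list_of_multiset (image_mset sqrt (eigenvalues (transpose B ** B)))) ! (j - 1)"

text \<open>Density of the isotropic normal law with mean \<open>m\<close> and covariance \<open>v\<close> times the
  identity. The second argument is the variance, whereas \<open>normal_density\<close> takes the
  standard deviation.\<close>

definition iso_normal_density :: "'a::euclidean_space \<Rightarrow> real \<Rightarrow> 'a \<Rightarrow> real" where
  "iso_normal_density m v x = (\<Prod>b\<in>Basis. normal_density (m \<bullet> b) (sqrt v) (x \<bullet> b))"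

definition alpha :: "real \<Rightarrow> real" where
  "alpha t = exp (- t / 2)"

definition hvar :: "real \<Rightarrow> real" where
  "hvar t = 1 - exp (- t)"

definition htilde :: "real \<Rightarrow> real \<Rightarrow> real" where
  "htilde \<sigma> t = (alpha t)\<^sup>2 * \<sigma>\<^sup>2 + hvar t"

definition forward_kernel :: "real \<Rightarrow> 'a::euclidean_space \<Rightarrow> 'a measure" where
  "forward_kernel t x0 = density lborel (iso_normal_density (alpha t *\<^sub>R x0) (hvar t))"

text \<open>The law of \<open>X\<^sub>t\<close> when \<open>X\<^sub>0\<close> has law \<open>p\<close>.\<close>

definition forward_law :: "'a::euclidean_space measure \<Rightarrow> real \<Rightarrow> 'a measure" where
  "forward_law p t = p \<bind> forward_kernel t"

text \<open>A density is determined only almost everywhere. Its gradient needs the smooth version,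
  which is the mixture of the transition densities. The lemma \<open>forward_law_eq_density\<close> below
  shows that it is a density of \<open>forward_law p t\<close>.\<close>

definition forward_density :: "'a::euclidean_space measure \<Rightarrow> real \<Rightarrow> 'a \<Rightarrow> real" where
  "forward_density p t x = (\<integral>x0. iso_normal_density (alpha t *\<^sub>R x0) (hvar t) x \<partial>p)"

definition ld_density :: "real \<Rightarrow> ('b::euclidean_space \<Rightarrow> real) \<Rightarrow> real \<Rightarrow> 'b \<Rightarrow> real" where
  "ld_density \<sigma> pz t y =
     (\<integral>z. iso_normal_density (alpha t *\<^sub>R z) (htilde \<sigma> t) y * pz z \<partial>lborel)"

definition score_risk ::
  "'a::euclidean_space measure \<Rightarrow> real \<Rightarrow> real \<Rightarrow> ('a \<Rightarrow> real \<Rightarrow> 'a) \<Rightarrow> ennreal" where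
  "score_risk p t0 T s =
     ennreal (1 / (T - t0)) *
     (\<integral>\<^sup>+t\<in>{t0..T}.
        (\<integral>\<^sup>+x. ennreal ((norm (s x t - gradient (\<lambda>x. ln (forward_density p t x)) x))\<^sup>2)
           \<partial>forward_law p t) \<partial>lborel)"

definition structured_score ::
  "real^'d1^'D \<Rightarrow> (real^'d1 \<Rightarrow> real \<Rightarrow> real^'d1) \<Rightarrow> real^'D \<Rightarrow> real \<Rightarrow> real^'D" where
  "structured_score V f x t =
     (1 / hvar t) *\<^sub>R (V *v f (transpose V *v x) t) - (1 / hvar t) *\<^sub>R x"

definition structural_class ::
  "real^'d1^'D \<Rightarrow> real \<Rightarrow> real \<Rightarrow> (real^'D \<Rightarrow> real \<Rightarrow> real^'D) set" where
  "structural_class V t0 T =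
     {structured_score V f | f.
        case_prod f \<in> borel_measurable (restrict_space borel (UNIV \<times> {t0..T}))}"

definition relu :: "real \<Rightarrow> real" where
  "relu x = max 0 x"

text \<open>Layer widths vary within a network, so weights and biases are functions on natural
  numbers: layer \<open>l\<close> (for \<open>1 \<le> l \<le> L\<close>) has a \<open>w l \<times> w (l - 1)\<close> weight matrix \<open>W l\<close> and
  a bias vector \<open>b l\<close> of length \<open>w l\<close>, both indexed from 0. Only entries within these
  bounds matter.\<close>

definition affine_layer ::
  "nat \<Rightarrow> (nat \<Rightarrow> nat \<Rightarrow> real) \<Rightarrow> (nat \<Rightarrow> real) \<Rightarrow> (nat \<Rightarrow> real) \<Rightarrow> nat \<Rightarrow> real" where
  "affine_layer n A c x i = (\<Sum>j<n. A i j * x j) + c i"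

primrec hidden_output ::
  "(nat \<Rightarrow> nat) \<Rightarrow> (nat \<Rightarrow> nat \<Rightarrow> nat \<Rightarrow> real) \<Rightarrow> (nat \<Rightarrow> nat \<Rightarrow> real) \<Rightarrow> (nat \<Rightarrow> real)
     \<Rightarrow> nat \<Rightarrow> nat \<Rightarrow> real" where
  "hidden_output w W b x 0 = x"
| "hidden_output w W b x (Suc l) =
     (\<lambda>i. relu (affine_layer (w l) (W (Suc l)) (b (Suc l)) (hidden_output w W b x l) i))"

text \<open>The input vector \<open>[z, t]\<close>: coordinates of \<open>z\<close> are numbered \<open>0, \<dots>, d - 1\<close> by the
  library bijection \<open>from_nat_into UNIV\<close>, and \<open>t\<close> has number \<open>d\<close>. The class of networks does
  not depend on the numbering.\<close>

definition network_input :: "real^'d \<Rightarrow> real \<Rightarrow> nat \<Rightarrow> real" where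
  "network_input z t j = (if j < CARD('d) then z $ from_nat_into UNIV j else t)"

definition relu_network ::
  "nat \<Rightarrow> (nat \<Rightarrow> nat) \<Rightarrow> (nat \<Rightarrow> nat \<Rightarrow> nat \<Rightarrow> real) \<Rightarrow> (nat \<Rightarrow> nat \<Rightarrow> real)
     \<Rightarrow> real^'d \<Rightarrow> real \<Rightarrow> real^'d" where
  "relu_network L w W b z t =
     (\<chi> i. affine_layer (w (L - 1)) (W L) (b L)
             (hidden_output w W b (network_input z t) (L - 1)) (to_nat_on UNIV i))"

text \<open>The width bound concerns the hidden layers. Membership constrains \<open>f\<close> only on
  \<open>UNIV \<times> {0..T}\<close>, the domain of the functions in the class.\<close>

definition relu_class ::
  "real \<Rightarrow> nat \<Rightarrow> nat \<Rightarrow> nat \<Rightarrow> real \<Rightarrow> real \<Rightarrow> real \<Rightarrow> real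
     \<Rightarrow> (real^'d \<Rightarrow> real \<Rightarrow> real^'d) set" where
  "relu_class T L M J K \<kappa> \<gamma> \<gamma>t =
     {f. 1 \<le> L \<and>
         (\<exists>w W b.
            w 0 = CARD('d) + 1 \<and> w L = CARD('d) \<and>
            (\<forall>l. 0 < l \<and> l < L \<longrightarrow> w l \<le> M) \<and>
            (\<forall>l\<in>{1..L}. \<forall>i<w l. (\<forall>j<w (l - 1). \<bar>W l i j\<bar> \<le> \<kappa>) \<and> \<bar>b l i\<bar> \<le> \<kappa>) \<and>
            (\<Sum>l=1..L. card {(i, j). i < w l \<and> j < w (l - 1) \<and> W l i j \<noteq> 0}
                        + card {i. i < w l \<and> b l i \<noteq> 0}) \<le> J \<and>
            (\<forall>z. \<forall>t\<in>{0..T}. f z t = relu_network L w W b z t)) \<and>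
         (\<forall>z. \<forall>t\<in>{0..T}. norm (f z t) \<le> K) \<and>
         (\<forall>z1 z2. \<forall>t\<in>{0..T}. norm (f z1 t - f z2 t) \<le> \<gamma> * norm (z1 - z2)) \<and>
         (\<forall>z. \<forall>t1\<in>{0..T}. \<forall>t2\<in>{0..T}. norm (f z t1 - f z t2) \<le> \<gamma>t * \<bar>t1 - t2\<bar>)}"

definition frozen_class ::
  "real^'d1^'D \<Rightarrow> real \<Rightarrow> real \<Rightarrow> nat \<Rightarrow> nat \<Rightarrow> nat \<Rightarrow> real \<Rightarrow> real \<Rightarrow> real \<Rightarrow> real
     \<Rightarrow> (real^'D \<Rightarrow> real \<Rightarrow> real^'D) set" where
  "frozen_class V t0 T L M J K \<kappa> \<gamma> \<gamma>t =
     {s \<in> structural_class V t0 T.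
        \<exists>f\<in>relu_class T L M J K \<kappa> \<gamma> \<gamma>t. s = structured_score V f}"

definition B_str :: "(real^'D) measure \<Rightarrow> real \<Rightarrow> real \<Rightarrow> real^'d1^'D \<Rightarrow> ennreal" where
  "B_str p t0 T V = (INF s\<in>structural_class V t0 T. score_risk p t0 T s)"

definition B_freeze ::
  "(real^'D) measure \<Rightarrow> real \<Rightarrow> real \<Rightarrow> real^'d1^'D \<Rightarrow> nat \<Rightarrow> nat \<Rightarrow> nat
     \<Rightarrow> real \<Rightarrow> real \<Rightarrow> real \<Rightarrow> real \<Rightarrow> ennreal" where
  "B_freeze p t0 T V L M J K \<kappa> \<gamma> \<gamma>t =
     (INF s\<in>frozen_class V t0 T L M J K \<kappa> \<gamma> \<gamma>t. score_risk p t0 T s)"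

lemma iso_normal_density_nonneg: "0 \<le> iso_normal_density m v x"
  unfolding iso_normal_density_def by (intro prod_nonneg) simp

lemma iso_normal_density_le:
  "v > 0 \<Longrightarrow> iso_normal_density m v (x::'a::euclidean_space) \<le> (1 / sqrt (2 * pi * v)) ^ DIM('a)"
proof -
  assume v: "v > 0"
  have "iso_normal_density m v x \<le> (\<Prod>b\<in>(Basis::'a set). 1 / sqrt (2 * pi * v))"
    unfolding iso_normal_density_def
  proof (intro prod_mono conjI)
    fix b :: 'a
    show "0 \<le> normal_density (m \<bullet> b) (sqrt v) (x \<bullet> b)" by simp
    have "exp (- (x \<bullet> b - m \<bullet> b)\<^sup>2 / (2 * v)) \<le> 1"
      using v by simp
    then have "1 / sqrt (2 * pi * v) * exp (- (x \<bullet> b - m \<bullet> b)\<^sup>2 / (2 * v)) \<le> 1 / sqrt (2 * pi * v) * 1"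
      using v by (intro mult_left_mono) auto
    then show "normal_density (m \<bullet> b) (sqrt v) (x \<bullet> b) \<le> 1 / sqrt (2 * pi * v)"
      using v by (simp add: normal_density_def)
  qed
  then show ?thesis by simp
qed

lemma iso_normal_density_measurable [measurable]:
  assumes [measurable]: "f \<in> borel_measurable M" "g \<in> borel_measurable M"
  shows "(\<lambda>\<omega>. iso_normal_density (f \<omega>) v (g \<omega> :: 'a::euclidean_space)) \<in> borel_measurable M"
  unfolding iso_normal_density_def normal_density_def by measurable

lemma nn_integral_iso_normal_density:
  assumes "v > 0"
  shows "(\<integral>\<^sup>+x. ennreal (iso_normal_density m v (x::'a::euclidean_space)) \<partial>lborel) = 1"
proof -
  have "(\<integral>\<^sup>+x. ennreal (iso_normal_density m v x) \<partial>lborel)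
      = (\<integral>\<^sup>+x. (\<Prod>b\<in>Basis. ennreal (normal_density (m \<bullet> b) (sqrt v) (x \<bullet> b))) \<partial>(lborel :: 'a measure))"
    unfolding iso_normal_density_def by (subst prod_ennreal) simp_all
  also have "\<dots> = (\<Prod>b\<in>(Basis :: 'a set). \<integral>\<^sup>+x. ennreal (normal_density (m \<bullet> b) (sqrt v) x) \<partial>lborel)"
    by (rule nn_integral_lborel_prod) simp_all
  also have "\<dots> = 1"
  proof (intro prod.neutral ballI)
    fix b :: 'a
    show "(\<integral>\<^sup>+x. ennreal (normal_density (m \<bullet> b) (sqrt v) x) \<partial>lborel) = 1"
      using assms by (subst nn_integral_eq_integral) simp_all
  qed
  finally show ?thesis .
qed

lemma hvar_pos: "t > 0 \<Longrightarrow> hvar t > 0"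
  by (simp add: hvar_def)

lemma prob_space_forward_kernel: "t > 0 \<Longrightarrow> prob_space (forward_kernel t x0)"
  unfolding forward_kernel_def
  by (rule prob_spaceI) (simp add: emeasure_density nn_integral_iso_normal_density hvar_pos)

lemma measurable_forward_kernel:
  assumes "t > 0"
  shows "forward_kernel t \<in> measurable borel (subprob_algebra (borel :: 'a::euclidean_space measure))"
proof (rule measurable_subprob_algebra)
  fix a :: 'a
  show "subprob_space (forward_kernel t a)"
    by (intro prob_space_imp_subprob_space prob_space_forward_kernel assms)
  show "sets (forward_kernel t a) = sets borel"
    by (simp add: forward_kernel_def)
next
  fix A :: "'a set" assume [measurable]: "A \<in> sets borel"
  have "(\<lambda>a. \<integral>\<^sup>+x. ennreal (iso_normal_density (alpha t *\<^sub>R a) (hvar t) x) * indicator A x \<partial>lborel)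
          \<in> borel_measurable borel"
    by measurable
  then show "(\<lambda>a. emeasure (forward_kernel t a) A) \<in> borel_measurable borel"
    by (simp add: forward_kernel_def emeasure_density)
qed

lemma forward_law_eq_density:
  fixes p :: "'a::euclidean_space measure"
  assumes p: "prob_space p" and sets_p [measurable_cong]: "sets p = sets borel" and t: "t > 0"
  shows "forward_law p t = density lborel (forward_density p t)"
proof -
  interpret prob_space p by (rule p)
  have ne: "space p \<noteq> {}" by (rule not_empty)
  have km: "forward_kernel t \<in> measurable p (subprob_algebra borel)"
    using measurable_forward_kernel[OF t] by (simp cong: measurable_cong_sets add: sets_p)
  have fd: "ennreal (forward_density p t x)
      = (\<integral>\<^sup>+x0. ennreal (iso_normal_density (alpha t *\<^sub>R x0) (hvar t) x) \<partial>p)" for x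
    unfolding forward_density_def
  proof (rule nn_integral_eq_integral[symmetric])
    show "integrable p (\<lambda>x0. iso_normal_density (alpha t *\<^sub>R x0) (hvar t) x)"
    proof (rule integrable_const_bound[where B = "(1 / sqrt (2 * pi * hvar t)) ^ DIM('a)"])
      show "AE x0 in p. norm (iso_normal_density (alpha t *\<^sub>R x0) (hvar t) x)
              \<le> (1 / sqrt (2 * pi * hvar t)) ^ DIM('a)"
        unfolding real_norm_def abs_of_nonneg[OF iso_normal_density_nonneg]
        by (intro AE_I2 iso_normal_density_le hvar_pos t)
    qed measurable
  qed (simp add: iso_normal_density_nonneg)
  show ?thesis
  proof (rule measure_eqI)
    show "sets (forward_law p t) = sets (density lborel (forward_density p t))"
      unfolding forward_law_def using sets_bind[OF _ ne, of "forward_kernel t" borel]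
      by (simp add: forward_kernel_def)
    fix A assume "A \<in> sets (forward_law p t)"
    then have A [measurable]: "A \<in> sets borel"
      unfolding forward_law_def using sets_bind[OF _ ne, of "forward_kernel t" borel]
      by (simp add: forward_kernel_def)
    have "emeasure (forward_law p t) A = (\<integral>\<^sup>+x0. emeasure (forward_kernel t x0) A \<partial>p)"
      unfolding forward_law_def by (rule emeasure_bind[OF ne km A])
    also have "\<dots> = (\<integral>\<^sup>+x0. \<integral>\<^sup>+x. ennreal (iso_normal_density (alpha t *\<^sub>R x0) (hvar t) x)
        * indicator A x \<partial>lborel \<partial>p)"
      by (simp add: forward_kernel_def emeasure_density)
    also have "\<dots> = (\<integral>\<^sup>+x. \<integral>\<^sup>+x0. ennreal (iso_normal_density (alpha t *\<^sub>R x0) (hvar t) x)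
        * indicator A x \<partial>p \<partial>lborel)"
    proof -
      interpret pair_sigma_finite lborel p ..
      show ?thesis by (rule Fubini') measurable
    qed
    also have "\<dots> = (\<integral>\<^sup>+x. ennreal (forward_density p t x) * indicator A x \<partial>lborel)"
      by (simp add: fd nn_integral_multc)
    also have "\<dots> = emeasure (density lborel (forward_density p t)) A"
    proof (rule emeasure_density[symmetric])
      show "(\<lambda>x. ennreal (forward_density p t x)) \<in> borel_measurable lborel"
        unfolding fd by measurable
    qed simp
    finally show "emeasure (forward_law p t) A = emeasure (density lborel (forward_density p t)) A" .
  qed
qed

end

theory Submission
  imports Defs
begin

text \<open>Write \<open>y = A\<^sup>T x\<close>, \<open>w = (I - A A\<^sup>T) x\<close> and \<open>c = 1 - h / h'\<close>, where \<open>h'\<close> is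
  \<open>htilde\<close>. Given the latent variable, \<open>X\<^sub>t\<close> is normal with mean \<open>\<alpha> A z\<close> and covariance
  \<open>h' I\<close>, so its density factors into the latent density at \<open>y\<close> and a Gaussian in \<open>w\<close>.
  Hence a structured score differs from the true one by \<open>(V f - A g - c w) / h\<close>, and projecting
  onto the orthogonal complement of the range of \<open>V\<close> removes \<open>f\<close>. The remaining two terms are
  uncorrelated because the law of \<open>X\<^sub>t\<close> is invariant under \<open>w \<mapsto> - w\<close>; the first is bounded
  below through the least eigenvalue of the second moment matrix of \<open>g\<close>, and the second is an
  explicit Gaussian moment. The traces of the projections that appear are expressed by the trace
  of \<open>B\<^sup>T B\<close> for \<open>B = V\<^sup>T A\<close>, which is the sum of the squared singular values of \<open>B\<close>.\<close>

subsection \<open>Spectral theory of symmetric matrices\<close>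

lemma symmetric_matrix_inner:
  fixes S :: "real^'n^'n"
  assumes "transpose S = S"
  shows "(S *v x) \<bullet> y = x \<bullet> (S *v y)"
  using assms by (metis dot_lmul_matrix vector_transpose_matrix)

text \<open>Rayleigh quotient argument: a maximiser of the quadratic form on the unit sphere of
  \<open>W\<close> is an eigenvector, with the maximum as eigenvalue. Working inside an invariant
  subspace prepares the induction on the dimension.\<close>

lemma symmetric_eigenvector_in_subspace:
  fixes S :: "real^'n^'n"
  assumes sym: "transpose S = S" and W: "subspace W" and inv: "\<And>w. w \<in> W \<Longrightarrow> S *v w \<in> W"
    and ne: "W \<noteq> {0}"
  obtains x d where "x \<in> W" "norm x = 1" "S *v x = d *\<^sub>R x"
proof -
  define K where "K = W \<inter> sphere 0 1"
  have "compact K"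
    unfolding K_def using W by (intro closed_Int_compact closed_subspace) auto
  moreover have "K \<noteq> {}"
  proof -
    obtain w where w: "w \<in> W" "w \<noteq> 0"
      using ne subspace_0[OF W] by blast
    then have "(1 / norm w) *\<^sub>R w \<in> K"
      unfolding K_def using W by (auto intro: subspace_scale)
    then show ?thesis by auto
  qed
  moreover have "continuous_on K (\<lambda>x. x \<bullet> (S *v x))"
    by (intro continuous_intros linear_continuous_on matrix_vector_mul_bounded_linear)
  ultimately obtain x where x: "x \<in> K" and max: "\<And>y. y \<in> K \<Longrightarrow> y \<bullet> (S *v y) \<le> x \<bullet> (S *v x)"
    using continuous_attains_sup by metis
  define d where "d = x \<bullet> (S *v x)"
  have xW: "x \<in> W" and nx: "norm x = 1" using x by (auto simp: K_def)
  have le: "w \<bullet> (S *v w) \<le> d * (w \<bullet> w)" if "w \<in> W" for w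
  proof (cases "w = 0")
    case False
    have "(1 / norm w) *\<^sub>R w \<in> K"
      unfolding K_def using W that False by (auto intro: subspace_scale)
    from max[OF this] have "(w \<bullet> (S *v w)) / (norm w)\<^sup>2 \<le> d"
      by (simp add: d_def matrix_vector_mult_scaleR power2_eq_square field_simps)
    then show ?thesis using False by (simp add: field_simps dot_square_norm)
  qed simp
  define u where "u = S *v x - d *\<^sub>R x"
  have uW: "u \<in> W" unfolding u_def using W xW inv by (intro subspace_diff subspace_scale) auto
  \<comment> \<open>The quadratic form of \<open>d - S\<close> is nonnegative on \<open>W\<close> and vanishes at \<open>x\<close>,
    so its derivative at \<open>x\<close> in the direction \<open>u\<close> vanishes.\<close>
  define c where "c = \<bar>u \<bullet> (S *v u) - d * (u \<bullet> u)\<bar> + 1"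
  have c: "c > 0" by (simp add: c_def)
  have "u \<bullet> u = 0"
  proof -
    \<comment> \<open>This step length maximises
      \<open>2 * t * (u \<bullet> u) - t\<^sup>2 * c\<close>. The maximum is the square of
      \<open>u \<bullet> u\<close> divided by \<open>c\<close>, so it can only be \<le> 0 if
      \<open>u = 0\<close>.\<close>
    define t where "t = (u \<bullet> u) / c"
    have "(x + t *\<^sub>R u) \<bullet> (S *v (x + t *\<^sub>R u)) \<le> d * ((x + t *\<^sub>R u) \<bullet> (x + t *\<^sub>R u))"
      using W xW uW by (intro le subspace_add subspace_scale)
    moreover have "x \<bullet> x = 1" using nx by (simp add: norm_eq_1)
    moreover have "x \<bullet> (S *v u) = u \<bullet> (S *v x)"
      using symmetric_matrix_inner[OF sym, of x u] by (simp add: inner_commute)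
    ultimately have "2 * t * (u \<bullet> (S *v x) - d * (u \<bullet> x)) + t\<^sup>2 * (u \<bullet> (S *v u) - d * (u \<bullet> u)) \<le> 0"
      unfolding d_def[symmetric]
      by (simp add: inner_add_left inner_add_right matrix_vector_right_distrib
          matrix_vector_mult_scaleR d_def[symmetric] inner_commute[of x u] algebra_simps power2_eq_square)
    moreover have "u \<bullet> (S *v x) - d * (u \<bullet> x) = u \<bullet> u"
      by (simp add: u_def inner_diff_right)
    ultimately have *: "2 * t * (u \<bullet> u) + t\<^sup>2 * (u \<bullet> (S *v u) - d * (u \<bullet> u)) \<le> 0" by simp
    have "t\<^sup>2 * (u \<bullet> (S *v u) - d * (u \<bullet> u)) \<ge> t\<^sup>2 * (- c)"
      by (intro mult_left_mono) (auto simp: c_def)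
    with * have "2 * t * (u \<bullet> u) - t\<^sup>2 * c \<le> 0" by simp
    moreover have "2 * t * (u \<bullet> u) - t\<^sup>2 * c = (u \<bullet> u)\<^sup>2 / c"
      using c by (simp add: t_def field_simps power2_eq_square)
    ultimately have "(u \<bullet> u)\<^sup>2 / c \<le> 0" by simp
    then show ?thesis using c by (simp add: divide_le_0_iff)
  qed
  then have "S *v x = d *\<^sub>R x" by (simp add: u_def)
  with xW nx show thesis by (rule that)
qed

text \<open>Induction on the dimension of \<open>W\<close>: one unit eigenvector \<open>x\<close> is
  split off, and by symmetry of \<open>S\<close> the vectors of \<open>W\<close> orthogonal to
  \<open>x\<close> form an invariant subspace of smaller dimension.\<close>

lemma symmetric_orthonormal_eigenbasis_subspace:
  fixes S :: "real^'n^'n"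
  assumes sym: "transpose S = S"
  shows "subspace W \<Longrightarrow> (\<And>w. w \<in> W \<Longrightarrow> S *v w \<in> W) \<Longrightarrow>
    \<exists>B. pairwise orthogonal B \<and> (\<forall>b\<in>B. norm b = 1 \<and> (\<exists>d. S *v b = d *\<^sub>R b)) \<and> span B = W"
proof (induction "dim W" arbitrary: W rule: less_induct)
  case less
  note W = less.prems(1) and inv = less.prems(2)
  show ?case
  proof (cases "W = {0}")
    case True
    then show ?thesis by (intro exI[of _ "{}"]) simp
  next
    case False
    from symmetric_eigenvector_in_subspace[OF sym W inv False] obtain x d
      where x: "x \<in> W" "norm x = 1" "S *v x = d *\<^sub>R x" by metis
    define W' where "W' = {w \<in> W. x \<bullet> w = 0}"
    have sub: "subspace W'"
      using W by (auto simp: W'_def subspace_def inner_add_right)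
    have xx: "x \<bullet> x = 1" using x(2) by (simp add: norm_eq_1)
    have "x \<notin> W'" using xx by (simp add: W'_def)
    then have "W' \<subset> W" using x(1) unfolding W'_def by blast
    then have "dim W' < dim W"
      using sub W by (simp add: dim_psubset span_eq_iff[THEN iffD2])
    moreover have "S *v w \<in> W'" if "w \<in> W'" for w
      using that inv symmetric_matrix_inner[OF sym, of x w] x(3) by (simp add: W'_def)
    ultimately obtain B where B: "pairwise orthogonal B"
      "\<And>b. b \<in> B \<Longrightarrow> norm b = 1 \<and> (\<exists>d. S *v b = d *\<^sub>R b)" "span B = W'"
      using less.hyps[OF _ sub] by metis
    have BW': "B \<subseteq> W'" using B(3) span_superset by blast
    have "span (insert x B) = W"
    proof
      show "span (insert x B) \<subseteq> W"
        using BW' x(1) W by (intro span_minimal) (auto simp: W'_def)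
      show "W \<subseteq> span (insert x B)"
      proof
        fix w assume "w \<in> W"
        then have "w - (x \<bullet> w) *\<^sub>R x \<in> W'"
          using W x(1) xx by (auto simp: W'_def inner_diff_right intro!: subspace_diff subspace_scale)
        then have "w - (x \<bullet> w) *\<^sub>R x \<in> span B" using B(3) by simp
        then show "w \<in> span (insert x B)" by (auto simp: span_insert)
      qed
    qed
    moreover have "pairwise orthogonal (insert x B)"
      using B(1) BW' by (auto simp: pairwise_insert W'_def orthogonal_def inner_commute)
    ultimately show ?thesis
      using B(2) x by (intro exI[of _ "insert x B"]) auto
  qed
qed

text \<open>Indexing by the type \<open>'n\<close> turns the eigenvectors into the columns of a
  square matrix and counts repeated eigenvalues with multiplicity.\<close>

definition orthonormal_eigenbasis :: "real^'n^'n \<Rightarrow> ('n \<Rightarrow> real^'n) \<Rightarrow> ('n \<Rightarrow> real) \<Rightarrow> bool" where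
  "orthonormal_eigenbasis S q d \<longleftrightarrow>
     (\<forall>i j. q i \<bullet> q j = (if i = j then 1 else 0)) \<and> (\<forall>i. S *v q i = d i *\<^sub>R q i)"

lemma symmetric_orthonormal_eigenbasis:
  fixes S :: "real^'n^'n"
  assumes "transpose S = S"
  obtains q d where "orthonormal_eigenbasis S q d"
proof -
  obtain B where B: "pairwise orthogonal B"
    "\<And>b. b \<in> B \<Longrightarrow> norm b = 1 \<and> (\<exists>d. S *v b = d *\<^sub>R b)" "span B = (UNIV :: (real^'n) set)"
    using symmetric_orthonormal_eigenbasis_subspace[OF assms, of UNIV] by auto
  have "0 \<notin> B" using B(2) by force
  then have ind: "independent B" using B(1) by (rule pairwise_orthogonal_independent[rotated])
  have "card B = CARD('n)"
    using ind B(3) by (metis dim_UNIV DIM_cart DIM_real dim_span_eq_card_independent mult.right_neutral)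
  moreover have "finite B" using ind independent_bound by blast
  ultimately obtain q where q: "bij_betw q (UNIV :: 'n set) B"
    using finite_same_card_bij[of "UNIV :: 'n set" B] by auto
  have qB: "q i \<in> B" for i using q by (auto simp: bij_betw_def)
  have "\<forall>i. \<exists>d. S *v q i = d *\<^sub>R q i" using B(2)[OF qB] by blast
  from choice[OF this] obtain d where d: "\<And>i. S *v q i = d i *\<^sub>R q i" by blast
  have "q i \<bullet> q j = (if i = j then 1 else 0)" for i j
  proof (cases "i = j")
    case True then show ?thesis using B(2)[OF qB] by (simp add: norm_eq_1)
  next
    case False
    then have "q i \<noteq> q j" using q by (auto simp: bij_betw_def inj_on_def)
    then show ?thesis using B(1) qB False by (simp add: pairwise_def orthogonal_def)
  qed
  with d show thesis by (intro that[of q d]) (simp add: orthonormal_eigenbasis_def)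
qed

text \<open>Evaluation at \<open>x\<close> is a ring homomorphism, so it passes through the
  determinant expansion.\<close>

lemma poly_charpoly: "poly (charpoly S) x = det (mat x - S)"
  by (auto simp: charpoly_def det_def poly_sum poly_prod mat_def intro!: sum.cong prod.cong)

lemma orthonormal_eigenbasis_matrix:
  fixes S :: "real^'n^'n"
  assumes "orthonormal_eigenbasis S q d"
  defines "Q \<equiv> (\<chi> i j. q j $ i) :: real^'n^'n"
  shows "transpose Q ** Q = mat 1" "S ** Q = Q ** (\<chi> i j. if i = j then d i else 0)"
proof -
  show "transpose Q ** Q = mat 1"
    using assms by (simp add: orthonormal_eigenbasis_def vec_eq_iff matrix_matrix_mult_def mat_def
        transpose_def inner_vec_def)
  have "(\<Sum>k\<in>UNIV. S $ i $ k * q j $ k) = d j * q j $ i" for i j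
  proof -
    have "(S *v q j) $ i = (d j *\<^sub>R q j) $ i" using assms by (simp add: orthonormal_eigenbasis_def)
    then show ?thesis by (simp add: matrix_vector_mult_def)
  qed
  then show "S ** Q = Q ** (\<chi> i j. if i = j then d i else 0)"
    by (simp add: Q_def vec_eq_iff matrix_matrix_mult_def if_distrib mult.commute cong: if_cong)
qed

text \<open>In the eigenbasis \<open>mat x - S\<close> becomes diagonal, and the nonzero factor
  \<open>det Q\<close> cancels. The identity is obtained at every real \<open>x\<close>, and real
  polynomials that agree as functions coincide.\<close>

lemma charpoly_eigenbasis:
  fixes S :: "real^'n^'n"
  assumes "orthonormal_eigenbasis S q d"
  shows "charpoly S = (\<Prod>i\<in>UNIV. [:- d i, 1:])"
proof -
  define Q :: "real^'n^'n" where "Q = (\<chi> i j. q j $ i)"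
  define D :: "real \<Rightarrow> real^'n^'n" where "D x = (\<chi> i j. if i = j then x - d i else 0)" for x
  note Q = orthonormal_eigenbasis_matrix[OF assms, folded Q_def]
  have nz: "det Q \<noteq> 0"
    using Q(1) by (metis det_I det_mul mult_zero_right zero_neq_one)
  have "det (mat x - S) = (\<Prod>i\<in>UNIV. x - d i)" for x
  proof -
    have "(mat x - S) ** Q = Q ** D x"
    proof -
      have "((mat x - S) ** Q) $ i $ j = (Q ** D x) $ i $ j" for i j
      proof -
        have "(S ** Q) $ i $ j = Q $ i $ j * d j"
          unfolding Q(2) by (simp add: matrix_matrix_mult_def if_distrib cong: if_cong)
        moreover have "((mat x - S) ** Q) $ i $ j = x * Q $ i $ j - (S ** Q) $ i $ j"
          by (simp add: matrix_matrix_mult_def mat_def left_diff_distrib sum_subtractf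
              if_distrib[of "\<lambda>a. a * _"] cong: if_cong)
        ultimately show ?thesis
          by (simp add: matrix_matrix_mult_def D_def if_distrib algebra_simps cong: if_cong)
      qed
      then show ?thesis by (simp add: vec_eq_iff)
    qed
    then have "det (mat x - S) * det Q = det Q * det (D x)"
      by (metis det_mul)
    moreover have "det (D x) = (\<Prod>i\<in>UNIV. x - d i)"
      by (subst det_diagonal) (auto simp: D_def)
    ultimately show ?thesis using nz by simp
  qed
  then have "poly (charpoly S) = poly (\<Prod>i\<in>UNIV. [:- d i, 1:])"
    by (simp add: fun_eq_iff poly_charpoly poly_prod)
  then show ?thesis by (simp only: poly_eq_poly_eq_iff)
qed

text \<open>Links \<open>eigenvalues\<close>, defined through roots, to the spectral theorem: each
  linear factor of the characteristic polynomial contributes one root.\<close>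

lemma eigenvalues_eigenbasis:
  fixes S :: "real^'n^'n"
  assumes "orthonormal_eigenbasis S q d"
  shows "eigenvalues S = image_mset d (mset_set UNIV)"
proof -
  have "eigenvalues S = (\<Sum>i\<in>UNIV. {#d i#})"
    unfolding eigenvalues_def charpoly_eigenbasis[OF assms] by (subst proots_prod) simp_all
  also have "(\<Sum>i\<in>A. {#d i#}) = image_mset d (mset_set A)" if "finite A" for A :: "'n set"
    using that by induction auto
  finally show ?thesis by simp
qed

text \<open>A left inverse of the square matrix \<open>Q\<close> is also a right inverse, and
  \<open>Q ** transpose Q = mat 1\<close> is the expansion in the basis.\<close>

lemma orthonormal_eigenbasis_expand:
  fixes S :: "real^'n^'n"
  assumes "orthonormal_eigenbasis S q d"
  shows "(\<Sum>i\<in>UNIV. (q i \<bullet> x) *\<^sub>R q i) = x"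
proof -
  define Q :: "real^'n^'n" where "Q = (\<chi> i j. q j $ i)"
  have "Q ** transpose Q = mat 1"
    using orthonormal_eigenbasis_matrix(1)[OF assms, folded Q_def] matrix_left_right_inverse by blast
  then have "Q *v (transpose Q *v x) = x"
    by (simp add: matrix_vector_mul_assoc del: transpose_matrix_vector)
  moreover have "Q *v (transpose Q *v x) = (\<Sum>i\<in>UNIV. (q i \<bullet> x) *\<^sub>R q i)"
    by (simp add: Q_def vec_eq_iff matrix_vector_mult_def transpose_def inner_vec_def mult.commute
        del: transpose_matrix_vector)
  ultimately show ?thesis by simp
qed

text \<open>In eigenbasis coordinates both sides are weighted sums of the same squares, and every
  weight \<open>d i\<close> is at least the minimum.\<close>

lemma lambda_min_le_quadratic_form:
  fixes S :: "real^'n^'n"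
  assumes "transpose S = S"
  shows "lambda_min S * (x \<bullet> x) \<le> x \<bullet> (S *v x)"
proof -
  obtain q d where qd: "orthonormal_eigenbasis S q d"
    using symmetric_orthonormal_eigenbasis[OF assms] .
  have min: "lambda_min S \<le> d i" for i
    unfolding lambda_min_def eigenvalues_eigenbasis[OF qd] by (intro Min_le) auto
  have ex: "x = (\<Sum>i\<in>UNIV. (q i \<bullet> x) *\<^sub>R q i)" using orthonormal_eigenbasis_expand[OF qd] by simp
  have Sx: "S *v x = (\<Sum>i\<in>UNIV. (d i * (q i \<bullet> x)) *\<^sub>R q i)"
    using qd by (subst ex) (simp add: linear_sum[OF matrix_vector_mul_linear] matrix_vector_mult_scaleR
        orthonormal_eigenbasis_def mult.commute)
  have "x \<bullet> x = (\<Sum>i\<in>UNIV. (q i \<bullet> x)\<^sup>2)"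
    by (subst (2) ex) (simp add: inner_sum_right power2_eq_square inner_commute)
  moreover have "x \<bullet> (S *v x) = (\<Sum>i\<in>UNIV. d i * (q i \<bullet> x)\<^sup>2)"
    unfolding Sx by (simp add: inner_sum_right power2_eq_square inner_commute mult.assoc)
  ultimately show ?thesis
    using min by (auto simp: sum_distrib_left intro!: sum_mono mult_right_mono)
qed

lemma trace_eigenbasis:
  fixes S :: "real^'n^'n"
  assumes "orthonormal_eigenbasis S q d"
  shows "trace S = (\<Sum>i\<in>UNIV. d i)"
proof -
  define Q :: "real^'n^'n" where "Q = (\<chi> i j. q j $ i)"
  define D :: "real^'n^'n" where "D = (\<chi> i j. if i = j then d i else 0)"
  note Q = orthonormal_eigenbasis_matrix[OF assms, folded Q_def D_def]
  have "Q ** transpose Q = mat 1" using Q(1) matrix_left_right_inverse by blast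
  then have "trace S = trace (S ** (Q ** transpose Q))" by simp
  also have "\<dots> = trace (transpose Q ** (S ** Q))"
    by (simp add: matrix_mul_assoc trace_mul_sym[of _ "transpose Q"])
  also have "\<dots> = trace D" using Q by (simp add: matrix_mul_assoc)
  finally show ?thesis by (simp add: D_def trace_def)
qed

section \<open>Singular values and the trace of the Gram matrix\<close>

text \<open>Descending order pushes the zeros of a nonnegative family to the end. With at most
  \<open>r\<close> nonzero entries, everything from position \<open>r\<close> on vanishes and
  truncation loses nothing.\<close>

lemma sum_largest_squares:
  fixes ms :: "real multiset"
  assumes nonneg: "\<And>x. x \<in># ms \<Longrightarrow> 0 \<le> x" and r: "r \<le> size ms" and few: "size {#x \<in># ms. x \<noteq> 0#} \<le> r"
  shows "(\<Sum>j=1..r. (rev (sorted_list_of_multiset ms) ! (j - 1))\<^sup>2) = (\<Sum>x\<in>#ms. x\<^sup>2)"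
proof -
  define l where "l = rev (sorted_list_of_multiset ms)"
  have len: "length l = size ms" unfolding l_def by (metis length_rev mset_sorted_list_of_multiset size_mset)
  have ms: "mset l = ms" by (simp add: l_def)
  have sorted: "l ! k \<le> l ! j" if "j \<le> k" "k < length l" for j k
    using that sorted_sorted_list_of_multiset[of ms] unfolding l_def
    by (metis sorted_rev_nth_mono rev_rev_ident)
  have zero: "l ! k = 0" if k: "r \<le> k" "k < length l" for k
  proof (rule ccontr)
    assume nz: "l ! k \<noteq> 0"
    have nn: "0 \<le> l ! k" using nonneg[of "l ! k"] ms k by (metis nth_mem_mset)
    \<comment> \<open>By the descending order all \<open>k + 1\<close> entries up to position
      \<open>k\<close> are positive, which is more than the \<open>r\<close> nonzero entries
      available.\<close>
    have "{..k} \<subseteq> {i. i < length l \<and> l ! i \<noteq> 0}"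
      using sorted k nz nn by (force intro: order.strict_trans1)
    then have "card {..k} \<le> card {i. i < length l \<and> l ! i \<noteq> 0}"
      by (intro card_mono) auto
    also have "\<dots> = length (filter (\<lambda>x. x \<noteq> 0) l)" by (simp add: length_filter_conv_card)
    also have "\<dots> = size {#x \<in># ms. x \<noteq> 0#}" by (metis ms mset_filter size_mset)
    finally show False using few k by simp
  qed
  \<comment> \<open>Singular values are numbered from 1, list positions from 0.\<close>
  have "(\<Sum>j=1..r. (l ! (j - 1))\<^sup>2) = (\<Sum>j<r. (l ! j)\<^sup>2)"
    by (rule sum.reindex_bij_witness[of _ Suc "\<lambda>j. j - 1"]) auto
  also have "\<dots> = (\<Sum>j<length l. (l ! j)\<^sup>2)"
    using r len zero by (intro sum.mono_neutral_left) auto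
  also have "\<dots> = sum_list (map (\<lambda>x. x\<^sup>2) l)"
    by (simp add: sum_list_sum_nth atLeast0LessThan)
  also have "\<dots> = (\<Sum>x\<in>#mset l. x\<^sup>2)" by (simp flip: sum_mset_sum_list)
  finally show ?thesis using ms by (simp add: l_def)
qed

text \<open>The squared singular values are eigenvalues of \<open>transpose B ** B\<close>, and all
  of these add up to the trace. The vectors \<open>B *v q i\<close> with \<open>d i\<close> nonzero
  are orthogonal and nonzero in the target space, so at most \<open>r\<close> eigenvalues are
  nonzero and the first \<open>r\<close> carry the whole trace.\<close>

lemma sum_singular_values_squared:
  fixes B :: "real^'n^'m"
  assumes r: "r = min CARD('m) CARD('n)"
  shows "(\<Sum>j=1..r. (singular_value B j)\<^sup>2) = trace (transpose B ** B)"
proof -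
  define S where "S = transpose B ** B"
  have "transpose S = S" by (simp add: S_def matrix_transpose_mul)
  then obtain q d where qd: "orthonormal_eigenbasis S q d"
    using symmetric_orthonormal_eigenbasis by blast
  have Bq: "(B *v q i) \<bullet> (B *v q j) = (if i = j then d i else 0)" for i j
  proof -
    have "(B *v q i) \<bullet> (B *v q j) = (S *v q i) \<bullet> q j"
      unfolding S_def by (metis dot_lmul_matrix inner_commute matrix_vector_mul_assoc vector_transpose_matrix)
    then show ?thesis using qd by (simp add: orthonormal_eigenbasis_def)
  qed
  have nonneg: "0 \<le> d i" for i using Bq[of i i] by (metis inner_ge_zero)
  define ms where "ms = image_mset sqrt (eigenvalues S)"
  have ms: "ms = image_mset (\<lambda>i. sqrt (d i)) (mset_set UNIV)"
    by (simp add: ms_def eigenvalues_eigenbasis[OF qd] multiset.map_comp comp_def)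
  have few: "size {#x \<in># ms. x \<noteq> 0#} \<le> r"
  proof -
    define I where "I = {i. d i \<noteq> 0}"
    have "size {#x \<in># ms. x \<noteq> 0#} = card I"
      by (simp add: ms I_def filter_mset_image_mset)
    moreover have "card I \<le> CARD('n)" by (intro card_mono) auto
    moreover have "card I \<le> CARD('m)"
    proof -
      have inj: "inj_on (\<lambda>i. B *v q i) I"
      proof (rule inj_onI)
        fix i j assume "i \<in> I" "j \<in> I" and eq: "B *v q i = B *v q j"
        show "i = j"
        proof (rule ccontr)
          assume "i \<noteq> j"
          then have "(B *v q i) \<bullet> (B *v q i) = 0" using eq Bq[of i j] by simp
          then show False using Bq[of i i] \<open>i \<in> I\<close> by (simp add: I_def)
        qed
      qed
      have "independent ((\<lambda>i. B *v q i) ` I)"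
      proof (rule pairwise_orthogonal_independent)
        show "pairwise orthogonal ((\<lambda>i. B *v q i) ` I)"
          unfolding pairwise_def orthogonal_def using Bq by (smt (verit) imageE)
        show "0 \<notin> (\<lambda>i. B *v q i) ` I"
        proof
          assume "0 \<in> (\<lambda>i. B *v q i) ` I"
          then obtain i where "i \<in> I" "B *v q i = 0" by force
          then show False using Bq[of i i] by (simp add: I_def)
        qed
      qed
      then have "card ((\<lambda>i. B *v q i) ` I) \<le> CARD('m)" using independent_bound by fastforce
      then show ?thesis by (simp add: card_image[OF inj])
    qed
    ultimately show ?thesis using r by simp
  qed
  have "(\<Sum>j=1..r. (singular_value B j)\<^sup>2) = (\<Sum>x\<in>#ms. x\<^sup>2)"
    unfolding singular_value_def S_def[symmetric] ms_def[symmetric]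
    using few by (intro sum_largest_squares) (auto simp: ms r nonneg)
  also have "\<dots> = (\<Sum>i\<in>UNIV. d i)"
    by (simp add: ms multiset.map_comp comp_def nonneg flip: sum_unfold_sum_mset)
  also have "\<dots> = trace S" using trace_eigenbasis[OF qd] by simp
  finally show ?thesis by (simp add: S_def)
qed

subsection \<open>Isotropic normal densities\<close>

text \<open>In this form only the distance from \<open>x\<close> to \<open>m\<close> enters, which
  exposes the invariance under orthogonal maps and lets Pythagoras split the exponent.\<close>

lemma iso_normal_density_eq:
  fixes m x :: "'a::euclidean_space"
  assumes "v > 0"
  shows "iso_normal_density m v x = (1 / sqrt (2 * pi * v)) ^ DIM('a) * exp (- (norm (x - m))\<^sup>2 / (2 * v))"
proof -
  have "iso_normal_density m v x
      = (\<Prod>b\<in>(Basis::'a set). 1 / sqrt (2 * pi * v)) * (\<Prod>b\<in>(Basis::'a set). exp (- (((x - m) \<bullet> b)\<^sup>2) / (2 * v)))"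
    using assms unfolding iso_normal_density_def normal_density_def
    by (simp add: prod.distrib[symmetric] inner_diff_left del: prod_constant)
  also have "(\<Prod>b\<in>(Basis::'a set). exp (- (((x - m) \<bullet> b)\<^sup>2) / (2 * v)))
      = exp (\<Sum>b\<in>(Basis::'a set). - (((x - m) \<bullet> b)\<^sup>2) / (2 * v))"
    by (simp add: exp_sum)
  also have "(\<Sum>b\<in>(Basis::'a set). - (((x - m) \<bullet> b)\<^sup>2) / (2 * v)) = - (norm (x - m))\<^sup>2 / (2 * v)"
    unfolding power2_norm_eq_inner euclidean_inner[of "x - m" "x - m"]
    by (simp add: sum_divide_distrib[symmetric] sum_negf power2_eq_square)
  finally show ?thesis by simp
qed

lemma iso_normal_density_pos: "v > 0 \<Longrightarrow> 0 < iso_normal_density m v (x::'a::euclidean_space)"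
  by (simp add: iso_normal_density_eq)

lemma nn_integral_lborel_translate:
  fixes f :: "'a::euclidean_space \<Rightarrow> ennreal"
  assumes [measurable]: "f \<in> borel_measurable borel"
  shows "(\<integral>\<^sup>+x. f (x + a) \<partial>lborel) = (\<integral>\<^sup>+x. f x \<partial>lborel)"
  by (subst (2) lborel_distr_plus[of a, symmetric]) (simp add: nn_integral_distr add.commute)

text \<open>The Fubini argument for uniqueness of Haar measure: the pushforward of Lebesgue measure
  under \<open>f\<close> is translation invariant, and it is compared with Lebesgue measure by integrating
  against a Gaussian, whose total mass \<open>f\<close> preserves.\<close>

lemma nn_integral_orthogonal_transformation:
  fixes f :: "'a::euclidean_space \<Rightarrow> 'a"
  assumes f: "orthogonal_transformation f" and u [measurable]: "u \<in> borel_measurable borel"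
  shows "(\<integral>\<^sup>+x. u (f x) \<partial>lborel) = (\<integral>\<^sup>+x. u x \<partial>lborel)"
proof -
  define G :: "'a \<Rightarrow> 'a \<Rightarrow> ennreal" where "G m x = ennreal (iso_normal_density m 1 x)" for m x
  have [measurable]: "case_prod G \<in> borel_measurable (borel \<Otimes>\<^sub>M borel)"
    unfolding G_def split_beta by measurable
  have G_eq: "G m x = ennreal ((1 / sqrt (2 * pi)) ^ DIM('a) * exp (- (norm (x - m))\<^sup>2 / 2))" for m x
    by (simp add: G_def iso_normal_density_eq)
  have G1: "(\<integral>\<^sup>+x. G m x \<partial>lborel) = 1" for m
    unfolding G_def by (rule nn_integral_iso_normal_density) simp
  have lin: "linear f" using f by (rule orthogonal_transformation_linear)
  have [measurable]: "f \<in> borel_measurable borel"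
    using lin by (intro borel_measurable_continuous_onI linear_continuous_on) (simp add: linear_conv_bounded_linear)
  define f' where "f' = inv f"
  have ff': "f (f' y) = y" for y
    unfolding f'_def using f by (simp add: orthogonal_transformation_surj surj_f_inv_f)
  \<comment> \<open>Since \<open>f\<close> preserves distances, the kernel as a function of
    \<open>x\<close> is again a normal density, centred at \<open>f' y\<close>. Its mass 1 closes
    the Fubini chain.\<close>
  have Gf: "G (f x) y = G (f' y) x" for x y
  proof -
    have "norm (y - f x) = norm (f (f' y - x))" using lin by (simp add: linear_diff ff')
    also have "\<dots> = norm (x - f' y)" using f by (simp add: orthogonal_transformation_norm norm_minus_commute)
    finally show ?thesis by (simp add: G_eq)
  qed
  have G0: "G 0 (y - a) = G a y" for y a by (simp add: G_eq)
  have "(\<integral>\<^sup>+x. u (f x) \<partial>lborel) = (\<integral>\<^sup>+y. G 0 y * (\<integral>\<^sup>+x. u (f x) \<partial>lborel) \<partial>lborel)"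
    by (simp add: nn_integral_multc G1)
  also have "\<dots> = (\<integral>\<^sup>+y. (\<integral>\<^sup>+x. G 0 y * u (f x) \<partial>lborel) \<partial>lborel)"
    by (simp add: nn_integral_cmult)
  also have "\<dots> = (\<integral>\<^sup>+y. (\<integral>\<^sup>+x. G 0 y * u (f x + y) \<partial>lborel) \<partial>lborel)"
  proof (rule nn_integral_cong)
    fix y :: 'a
    have "(\<integral>\<^sup>+x. G 0 y * u (f (x + f' y)) \<partial>lborel) = (\<integral>\<^sup>+x. G 0 y * u (f x) \<partial>lborel)"
      by (rule nn_integral_lborel_translate) simp
    then show "(\<integral>\<^sup>+x. G 0 y * u (f x) \<partial>lborel) = (\<integral>\<^sup>+x. G 0 y * u (f x + y) \<partial>lborel)"
      using lin by (simp add: linear_add ff')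
  qed
  also have "\<dots> = (\<integral>\<^sup>+x. (\<integral>\<^sup>+y. G 0 y * u (f x + y) \<partial>lborel) \<partial>lborel)"
    by (rule lborel_pair.Fubini') measurable
  also have "\<dots> = (\<integral>\<^sup>+x. (\<integral>\<^sup>+y. G (f x) y * u y \<partial>lborel) \<partial>lborel)"
  proof (rule nn_integral_cong)
    fix x :: 'a
    have "(\<integral>\<^sup>+y. G (f x) (y + f x) * u (y + f x) \<partial>lborel) = (\<integral>\<^sup>+y. G (f x) y * u y \<partial>lborel)"
      by (rule nn_integral_lborel_translate) simp
    then show "(\<integral>\<^sup>+y. G 0 y * u (f x + y) \<partial>lborel) = (\<integral>\<^sup>+y. G (f x) y * u y \<partial>lborel)"
      by (simp add: G_eq add.commute)
  qed
  also have "\<dots> = (\<integral>\<^sup>+y. (\<integral>\<^sup>+x. G (f x) y * u y \<partial>lborel) \<partial>lborel)"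
    by (rule lborel_pair.Fubini') measurable
  also have "\<dots> = (\<integral>\<^sup>+y. u y \<partial>lborel)"
    unfolding Gf by (simp add: nn_integral_multc G1)
  finally show ?thesis .
qed

section \<open>Convolution and second moments of normal densities\<close>

text \<open>The substitution \<open>u = a * e\<close> makes the noise a centred normal of deviation
  \<open>a * s\<close>. The integral is then a convolution of two centred normal densities at
  \<open>x - a * m\<close>, and the variances add.\<close>

lemma nn_integral_normal_density_conv_scaled:
  assumes "0 < h" "0 < s" "0 < a"
  shows "(\<integral>\<^sup>+e. ennreal (normal_density (a * m + a * e) (sqrt h) x * normal_density 0 s e) \<partial>lborel)
    = ennreal (normal_density (a * m) (sqrt (a\<^sup>2 * s\<^sup>2 + h)) x)"
proof -
  have eq: "normal_density (a * m + a * e) (sqrt h) x * normal_density 0 s e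
      = a * (normal_density 0 (sqrt h) ((x - a * m) - a * e) * normal_density 0 (a * s) (a * e))" for e
    using assms by (simp add: normal_density_def real_sqrt_mult power_mult_distrib diff_diff_eq)
  have "(\<integral>\<^sup>+e. ennreal (normal_density (a * m + a * e) (sqrt h) x * normal_density 0 s e) \<partial>lborel)
     = ennreal a * (\<integral>\<^sup>+e. ennreal (normal_density 0 (sqrt h) ((x - a * m) - a * e) * normal_density 0 (a * s) (a * e)) \<partial>lborel)"
    unfolding eq using assms by (simp add: ennreal_mult' nn_integral_cmult)
  also have "\<dots> = (\<integral>\<^sup>+u. ennreal (normal_density 0 (sqrt h) ((x - a * m) - u) * normal_density 0 (a * s) u) \<partial>lborel)"
    using assms by (subst nn_integral_real_affine[where c = a and t = 0]) auto
  also have "\<dots> = ennreal (normal_density 0 (sqrt (h + (a * s)\<^sup>2)) (x - a * m))"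
    using conv_normal_density_zero_mean[of "sqrt h" "a * s"] assms by (auto dest!: fun_cong[of _ _ "x - a * m"])
  also have "\<dots> = ennreal (normal_density (a * m) (sqrt (a\<^sup>2 * s\<^sup>2 + h)) x)"
    by (simp add: normal_density_def power_mult_distrib add.commute)
  finally show ?thesis .
qed

text \<open>Isotropic densities factor over the coordinates, which reduces the claim to dimension
  one. For \<open>a = alpha t\<close>, \<open>s = \<sigma>\<close> and \<open>h = hvar t\<close> the
  resulting variance is \<open>htilde \<sigma> t\<close>.\<close>

lemma nn_integral_iso_normal_density_conv_scaled:
  fixes m x :: "'a::euclidean_space"
  assumes "0 < h" "0 < s" "0 < a"
  shows "(\<integral>\<^sup>+e. ennreal (iso_normal_density (a *\<^sub>R (m + e)) h x * iso_normal_density 0 (s\<^sup>2) e) \<partial>lborel)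
    = ennreal (iso_normal_density (a *\<^sub>R m) (a\<^sup>2 * s\<^sup>2 + h) x)"
proof -
  have "(\<integral>\<^sup>+e. ennreal (iso_normal_density (a *\<^sub>R (m + e)) h x * iso_normal_density 0 (s\<^sup>2) e) \<partial>lborel)
    = (\<integral>\<^sup>+e. (\<Prod>b\<in>Basis. ennreal (normal_density (a * (m \<bullet> b) + a * (e \<bullet> b)) (sqrt h) (x \<bullet> b)
        * normal_density 0 s (e \<bullet> b))) \<partial>lborel)"
    using assms by (subst prod_ennreal)
      (simp_all add: iso_normal_density_def prod.distrib inner_add_left distrib_left)
  also have "\<dots> = (\<Prod>b\<in>(Basis::'a set). \<integral>\<^sup>+e. ennreal (normal_density (a * (m \<bullet> b) + a * e) (sqrt h) (x \<bullet> b)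
        * normal_density 0 s e) \<partial>lborel)"
    by (rule nn_integral_lborel_prod) (simp_all add: normal_density_def)
  also have "\<dots> = (\<Prod>b\<in>(Basis::'a set). ennreal (normal_density (a * (m \<bullet> b)) (sqrt (a\<^sup>2 * s\<^sup>2 + h)) (x \<bullet> b)))"
    using assms by (simp add: nn_integral_normal_density_conv_scaled)
  also have "\<dots> = ennreal (iso_normal_density (a *\<^sub>R m) (a\<^sup>2 * s\<^sup>2 + h) x)"
    by (subst prod_ennreal) (simp_all add: iso_normal_density_def)
  finally show ?thesis .
qed

text \<open>By rotation invariance of Lebesgue measure and of the density, \<open>n\<close> may be
  replaced by a multiple of a basis vector \<open>k\<close>. The integral then factors: coordinate
  \<open>k\<close> gives the variance \<open>v\<close>, every other coordinate gives mass 1.\<close>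

lemma nn_integral_iso_normal_second_moment:
  fixes n :: "real^'n"
  assumes v: "0 < v"
  shows "(\<integral>\<^sup>+w. ennreal ((n \<bullet> w)\<^sup>2 * iso_normal_density 0 v w) \<partial>lborel) = ennreal (v * (norm n)\<^sup>2)"
proof -
  obtain k :: "real^'n" where k: "k \<in> Basis" using nonempty_Basis by (meson ex_in_conv)
  have "norm n = norm (norm n *\<^sub>R k)" using k by simp
  then obtain f where f: "orthogonal_transformation f" "f n = norm n *\<^sub>R k"
    using orthogonal_transformation_exists[of n "norm n *\<^sub>R k"] by metis
  have "(\<integral>\<^sup>+w. ennreal ((n \<bullet> w)\<^sup>2 * iso_normal_density 0 v w) \<partial>lborel)
      = (\<integral>\<^sup>+w. ennreal ((f n \<bullet> f w)\<^sup>2 * iso_normal_density 0 v (f w)) \<partial>lborel)"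
    using f(1) v by (simp add: iso_normal_density_eq orthogonal_transformation_norm orthogonal_transformation_def)
  also have "\<dots> = (\<integral>\<^sup>+w. ennreal ((f n \<bullet> w)\<^sup>2 * iso_normal_density 0 v w) \<partial>lborel)"
    using f(1) by (rule nn_integral_orthogonal_transformation) measurable
  also have "\<dots> = (\<integral>\<^sup>+w. ennreal ((norm n)\<^sup>2) * ennreal ((w \<bullet> k)\<^sup>2 * iso_normal_density 0 v w) \<partial>lborel)"
    by (simp add: f(2) power_mult_distrib inner_commute mult.assoc flip: ennreal_mult')
  also have "\<dots> = ennreal ((norm n)\<^sup>2) * (\<integral>\<^sup>+w. ennreal ((w \<bullet> k)\<^sup>2 * iso_normal_density 0 v w) \<partial>lborel)"
    by (rule nn_integral_cmult) measurable
  also have "(\<integral>\<^sup>+w. ennreal ((w \<bullet> k)\<^sup>2 * iso_normal_density 0 v w) \<partial>lborel)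
      = (\<integral>\<^sup>+w. (\<Prod>b\<in>Basis. ennreal ((if b = k then (w \<bullet> b)\<^sup>2 else 1) * normal_density 0 (sqrt v) (w \<bullet> b))) \<partial>lborel)"
    using k by (subst prod_ennreal) (simp_all add: iso_normal_density_def prod.distrib prod.delta)
  also have "\<dots> = (\<Prod>b\<in>(Basis::(real^'n) set). \<integral>\<^sup>+w. ennreal ((if b = k then w\<^sup>2 else 1) * normal_density 0 (sqrt v) w) \<partial>lborel)"
    by (rule nn_integral_lborel_prod) (auto simp: normal_density_def)
  also have "\<dots> = (\<Prod>b\<in>(Basis::(real^'n) set). if b = k then ennreal v else 1)"
  proof (rule prod.cong[OF refl])
    fix b :: "real^'n"
    have "has_bochner_integral lborel (\<lambda>x. normal_density 0 (sqrt v) x * x\<^sup>2) v"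
      using normal_moment_even[of "sqrt v" 0 1] v by simp
    then have "(\<integral>\<^sup>+w. ennreal (w\<^sup>2 * normal_density 0 (sqrt v) w) \<partial>lborel) = ennreal v"
      by (subst nn_integral_eq_integral) (auto simp: has_bochner_integral_iff mult.commute)
    moreover have "(\<integral>\<^sup>+w. ennreal (normal_density 0 (sqrt v) w) \<partial>lborel) = 1"
      using v by (subst nn_integral_eq_integral) simp_all
    ultimately show "(\<integral>\<^sup>+w. ennreal ((if b = k then w\<^sup>2 else 1) * normal_density 0 (sqrt v) w) \<partial>lborel)
        = (if b = k then ennreal v else 1)" by simp
  qed
  also have "\<dots> = ennreal v" using k by (simp add: prod.delta)
  finally show ?thesis using v by (simp add: mult.commute ennreal_mult)
qed

section \<open>Differentiation of Gaussian mixtures\<close>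

text \<open>A rescaling of \<open>exp (- y) * y \<le> 1\<close>. It keeps the derivatives of the
  Gaussian kernel bounded uniformly in the mean.\<close>

lemma gaussian_norm_sq_le:
  fixes u :: "'a::real_inner"
  assumes "0 < v"
  shows "exp (- (norm u)\<^sup>2 / (2 * v)) * (norm u)\<^sup>2 \<le> 2 * v"
proof -
  define y where "y = (norm u)\<^sup>2 / (2 * v)"
  have "y \<le> exp y" using exp_ge_add_one_self[of y] by linarith
  then have "exp (- y) * y \<le> exp (- y) * exp y" by (intro mult_left_mono) auto
  then have "exp (- y) * y * (2 * v) \<le> 1 * (2 * v)" using assms by (intro mult_right_mono) (auto simp flip: exp_add)
  then have "exp (- y) * (y * (2 * v)) \<le> 2 * v" by (simp add: mult.assoc)
  moreover have "y * (2 * v) = (norm u)\<^sup>2" using assms by (simp add: y_def)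
  ultimately show ?thesis by (simp add: y_def)
qed

text \<open>Second-order Taylor expansion along the segment from \<open>u\<close> to
  \<open>u + k\<close>. At the intermediate point the second derivative is a difference of two
  nonnegative terms, at most \<open>2 * (norm k)\<^sup>2 / v\<close> (Cauchy-Schwarz and
  \<open>gaussian_norm_sq_le\<close>) and \<open>(norm k)\<^sup>2 / v\<close>. Half of their sum
  bounds the remainder.\<close>

lemma gaussian_taylor_remainder:
  fixes u k :: "'a::real_inner"
  assumes v: "0 < v"
  defines "E \<equiv> \<lambda>u::'a. exp (- (norm u)\<^sup>2 / (2 * v))"
  shows "\<bar>E (u + k) - E u + E u * (u \<bullet> k) / v\<bar> \<le> 3 / (2 * v) * (norm k)\<^sup>2"
proof -
  define E' where "E' s = - E (u + s *\<^sub>R k) * ((u + s *\<^sub>R k) \<bullet> k) / v" for s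
  define E'' where "E'' s = E (u + s *\<^sub>R k) * ((((u + s *\<^sub>R k) \<bullet> k) / v)\<^sup>2 - (norm k)\<^sup>2 / v)" for s
  have E0: "((\<lambda>s. E (u + s *\<^sub>R k)) has_real_derivative E' s) (at s)" for s
  proof -
    have q: "(norm (u + s *\<^sub>R k))\<^sup>2 = u \<bullet> u + 2 * s * (u \<bullet> k) + s\<^sup>2 * (k \<bullet> k)" for s
      unfolding power2_norm_eq_inner
      by (simp add: inner_add_left inner_add_right inner_commute power2_eq_square)
    have "((\<lambda>s. - (u \<bullet> u + 2 * s * (u \<bullet> k) + s\<^sup>2 * (k \<bullet> k)) / (2 * v)) has_real_derivative
        - ((u + s *\<^sub>R k) \<bullet> k) / v) (at s)"
      by (rule derivative_eq_intros refl)+ (use v in \<open>simp_all add: inner_add_left field_simps\<close>)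
    from DERIV_chain2[OF DERIV_exp this] show ?thesis unfolding E_def E'_def q by simp
  qed
  have E1: "(E' has_real_derivative E'' s) (at s)" for s
  proof -
    have L: "((\<lambda>s. (u + s *\<^sub>R k) \<bullet> k) has_real_derivative (norm k)\<^sup>2) (at s)"
      unfolding inner_add_left inner_scaleR_left power2_norm_eq_inner
      by (auto intro!: derivative_eq_intros)
    show ?thesis
      unfolding E'_def[abs_def]
      by (rule DERIV_cong[OF DERIV_cdivide[OF DERIV_mult[OF DERIV_minus[OF E0] L]]])
         (use v in \<open>simp add: E'_def E''_def field_simps power2_eq_square\<close>)
  qed
  define diff where "diff m = (if m = 0 then (\<lambda>s. E (u + s *\<^sub>R k)) else if m = 1 then E' else E'')" for m :: nat
  have "\<exists>t. 0 < t \<and> t \<le> 1 \<and> (\<lambda>s. E (u + s *\<^sub>R k)) 1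
      = (\<Sum>m<2. diff m 0 / fact m * 1 ^ m) + diff 2 t / fact 2 * 1 ^ 2"
  proof (rule Maclaurin2)
    show "\<forall>m t. m < 2 \<and> 0 \<le> t \<and> t \<le> 1 \<longrightarrow> (diff m has_real_derivative diff (Suc m) t) (at t)"
      using E0 E1 by (auto simp: diff_def less_2_cases_iff)
  qed (auto simp: diff_def)
  then obtain t where t: "E (u + k) = E u + E' 0 + E'' t / 2"
    by (auto simp: diff_def numeral_2_eq_2)
  define w where "w = u + t *\<^sub>R k"
  have "((w \<bullet> k) / v)\<^sup>2 \<le> (norm w)\<^sup>2 * (norm k)\<^sup>2 / v\<^sup>2"
    using Cauchy_Schwarz_ineq[of w k] by (simp add: power_divide divide_right_mono power2_norm_eq_inner)
  then have "E w * ((w \<bullet> k) / v)\<^sup>2 \<le> E w * ((norm w)\<^sup>2 * (norm k)\<^sup>2 / v\<^sup>2)"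
    by (intro mult_left_mono) (auto simp: E_def)
  also have "\<dots> = (E w * (norm w)\<^sup>2) * ((norm k)\<^sup>2 / v\<^sup>2)" by simp
  also have "\<dots> \<le> (2 * v) * ((norm k)\<^sup>2 / v\<^sup>2)"
    using gaussian_norm_sq_le[OF v, of w] by (intro mult_right_mono) (auto simp: E_def)
  finally have 1: "E w * ((w \<bullet> k) / v)\<^sup>2 \<le> 2 * (norm k)\<^sup>2 / v" using v by (simp add: power2_eq_square)
  have "E w \<le> 1" using v by (simp add: E_def)
  then have 2: "E w * ((norm k)\<^sup>2 / v) \<le> (norm k)\<^sup>2 / v" using v by (intro mult_left_le_one_le) (auto simp: E_def)
  have 3: "0 \<le> E w * ((w \<bullet> k) / v)\<^sup>2" "0 \<le> E w * ((norm k)\<^sup>2 / v)" using v by (auto simp: E_def)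
  have "E'' t = E w * ((w \<bullet> k) / v)\<^sup>2 - E w * ((norm k)\<^sup>2 / v)"
    by (simp add: E''_def w_def right_diff_distrib)
  with 1 2 3 have "\<bar>E'' t\<bar> \<le> 3 * ((norm k)\<^sup>2 / v)" unfolding abs_le_iff by (simp; linarith)
  then have "\<bar>E'' t / 2\<bar> \<le> 3 / (2 * v) * (norm k)\<^sup>2" by simp
  moreover have "E (u + k) - E u + E u * (u \<bullet> k) / v = E'' t / 2" using t by (simp add: E'_def)
  ultimately show ?thesis by (simp only:)
qed

text \<open>The uniformly quadratic remainder of the Gaussian kernel survives averaging over the
  mean, so no dominated convergence is needed.\<close>

lemma GDERIV_normal_mixture:
  fixes m :: "'c \<Rightarrow> 'a::euclidean_space"
  assumes N: "prob_space N" and m [measurable]: "m \<in> borel_measurable N" and v: "0 < v"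
  shows "GDERIV (\<lambda>y. \<integral>z. iso_normal_density (m z) v y \<partial>N) y
    :> (\<integral>z. (iso_normal_density (m z) v y / v) *\<^sub>R (m z - y) \<partial>N)"
proof -
  interpret prob_space N by (rule N)
  define C where "C = (1 / sqrt (2 * pi * v)) ^ DIM('a)"
  have C: "0 < C" using v by (simp add: C_def)
  define E where "E u = exp (- (norm u)\<^sup>2 / (2 * v))" for u :: 'a
  have iso: "iso_normal_density (m z) v y = C * E (y - m z)" for y z
    using v by (simp add: iso_normal_density_eq C_def E_def)
  have [measurable]: "E \<in> borel_measurable borel" unfolding E_def by measurable
  have E01: "0 \<le> E u" "E u \<le> 1" for u using v by (auto simp: E_def)
  have int0: "integrable N (\<lambda>z. C * E (y - m z))" for y
    by (rule integrable_const_bound[where B = C]) (use C E01 in \<open>auto simp: abs_mult\<close>)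
  have int1: "integrable N (\<lambda>z. (C * E (y - m z) / v) *\<^sub>R (m z - y))" for y
  proof (rule integrable_const_bound[where B = "C / v * (1 + 2 * v)"])
    \<comment> \<open>The estimate \<open>norm u \<le> 1 + (norm u)\<^sup>2\<close> trades the
      linear factor for the quadratic one, which \<open>gaussian_norm_sq_le\<close>
      controls.\<close>
    have "E u * norm u \<le> 1 + 2 * v" for u
    proof -
      have "norm u \<le> 1 + (norm u)\<^sup>2"
        using zero_le_power2[of "norm u - 1"] norm_ge_zero[of u] by (simp add: power2_diff; linarith)
      then have "E u * norm u \<le> E u * (1 + (norm u)\<^sup>2)" using E01 by (intro mult_left_mono)
      also have "\<dots> \<le> 1 + 2 * v"
        using gaussian_norm_sq_le[OF v, of u, folded E_def] E01(2)[of u] by (simp add: distrib_left)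
      finally show ?thesis .
    qed
    from mult_left_mono[OF this, of "C / v"]
    have "C / v * (E (y - m z) * norm (y - m z)) \<le> C / v * (1 + 2 * v)" for z
      using C v by simp
    then show "AE z in N. norm ((C * E (y - m z) / v) *\<^sub>R (m z - y)) \<le> C / v * (1 + 2 * v)"
      using C v E01 by (intro AE_I2) (simp add: abs_mult norm_minus_commute mult.assoc)
  qed measurable
  define F where "F y = (\<integral>z. C * E (y - m z) \<partial>N)" for y
  define G where "G = (\<integral>z. (C * E (y - m z) / v) *\<^sub>R (m z - y) \<partial>N)"
  have bound: "\<bar>F (y + k) - F y - k \<bullet> G\<bar> \<le> C * (3 / (2 * v)) * (norm k)\<^sup>2" for k
  proof -
    \<comment> \<open>The Taylor remainder of the kernel centred at \<open>m z\<close>. Averaged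
      over \<open>z\<close>, the linear terms collect into \<open>k \<bullet> G\<close>.\<close>
    define R where "R z = C * (E (y - m z + k) - E (y - m z) + E (y - m z) * ((y - m z) \<bullet> k) / v)" for z
    have kG: "k \<bullet> G = (\<integral>z. k \<bullet> ((C * E (y - m z) / v) *\<^sub>R (m z - y)) \<partial>N)"
      unfolding G_def by (rule integral_inner_right[symmetric]) (rule int1)
    have "F (y + k) - F y - k \<bullet> G = (\<integral>z. C * E (y + k - m z) - C * E (y - m z)
        - k \<bullet> ((C * E (y - m z) / v) *\<^sub>R (m z - y)) \<partial>N)"
      unfolding kG F_def
      by (simp only: Bochner_Integration.integral_diff Bochner_Integration.integrable_diff int0 int1
          integrable_inner_right)
    also have "\<dots> = (\<integral>z. R z \<partial>N)"
      unfolding R_def by (intro Bochner_Integration.integral_cong refl)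
        (simp add: algebra_simps inner_commute[of k] diff_divide_distrib)
    finally have eq: "F (y + k) - F y - k \<bullet> G = (\<integral>z. R z \<partial>N)" .
    have R: "\<bar>R z\<bar> \<le> C * (3 / (2 * v)) * (norm k)\<^sup>2" for z
      using mult_left_mono[OF gaussian_taylor_remainder[OF v, of "y - m z" k], of C] C
      by (simp add: R_def E_def abs_mult mult.assoc)
    have [measurable]: "R \<in> borel_measurable N" unfolding R_def by measurable
    have "integrable N R"
      by (rule integrable_const_bound[where B = "C * (3 / (2 * v)) * (norm k)\<^sup>2"])
         (use R in auto)
    then have "\<bar>\<integral>z. R z \<partial>N\<bar> \<le> (\<integral>z. C * (3 / (2 * v)) * (norm k)\<^sup>2 \<partial>N)"
      using R by (intro integral_abs_bound[THEN order_trans] integral_mono) auto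
    then show ?thesis using eq by (simp add: prob_space)
  qed
  have "(\<lambda>k. norm (F (y + k) - F y - k \<bullet> G) / norm k) \<midarrow>0\<rightarrow> 0"
  proof (rule tendsto_sandwich[of "\<lambda>_. 0" _ _ "\<lambda>k. C * (3 / (2 * v)) * norm k"])
    show "\<forall>\<^sub>F k in at 0. norm (F (y + k) - F y - k \<bullet> G) / norm k \<le> C * (3 / (2 * v)) * norm k"
      unfolding eventually_at_filter
      using bound by (auto simp: divide_le_eq power2_eq_square mult.assoc intro!: always_eventually)
    show "(\<lambda>k. C * (3 / (2 * v)) * norm k) \<midarrow>0\<rightarrow> (0::real)"
      using v by (auto intro!: tendsto_eq_intros)
  qed auto
  then have "(F has_derivative (\<lambda>k. k \<bullet> G)) (at y)"
    unfolding has_derivative_at by (auto intro: bounded_linear_inner_left)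
  then show ?thesis using v by (simp add: gderiv_def iso F_def[abs_def] G_def)
qed

text \<open>Uniqueness of the derivative resolves the definite description in
  \<open>gradient\<close>: two representing vectors have equal inner products with every
  \<open>h\<close>, hence agree.\<close>

lemma gradient_eqI:
  assumes "GDERIV f x :> D"
  shows "gradient f x = D"
  unfolding gradient_def
proof (rule the_equality)
  show "GDERIV f x :> D" by (rule assms)
  fix D' assume "GDERIV f x :> D'"
  with assms have "(\<lambda>h. h \<bullet> D') = (\<lambda>h. h \<bullet> D)"
    unfolding gderiv_def by (rule has_derivative_unique[rotated])
  then show "D' = D" by (metis inner_eq_zero_iff inner_diff_right right_minus_eq)
qed

subsection \<open>Isometries and projections\<close>

text \<open>Keeps products \<open>transpose A *v x\<close> in this form instead of letting
  simplification turn them into \<open>x v* A\<close>; the rules for isometries below are stated in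
  that form.\<close>

declare transpose_matrix_vector [simp del] vector_transpose_matrix [simp del]

lemma inner_matrix_transpose:
  fixes A :: "real^'n^'m"
  shows "(A *v y) \<bullet> x = y \<bullet> (transpose A *v x)"
  by (metis dot_lmul_matrix transpose_matrix_vector inner_commute)

lemma matrix_mult_diff_left:
  fixes X Y :: "real^'n^'m"
  shows "(X - Y) ** Z = X ** Z - Y ** Z"
  by (simp add: vec_eq_iff matrix_matrix_mult_def left_diff_distrib sum_subtractf)

lemma matrix_mult_diff_right:
  fixes Z :: "real^'n^'m"
  shows "Z ** (X - Y) = Z ** X - Z ** Y"
  by (simp add: vec_eq_iff matrix_matrix_mult_def right_diff_distrib sum_subtractf)

lemma transpose_diff: "transpose (X - Y) = transpose X - transpose (Y :: real^'n^'m)"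
  by (simp add: vec_eq_iff transpose_def)

text \<open>The squared Frobenius norm of \<open>C\<close>, taken by rows. Together with
  \<open>norm_matrix_vector_squared\<close> it turns integrals of the squared norm of
  \<open>C *v x\<close> into traces.\<close>

lemma trace_mult_transpose:
  fixes C :: "real^'n^'m"
  shows "trace (C ** transpose C) = (\<Sum>i\<in>UNIV. (norm (C $ i))\<^sup>2)"
  by (simp add: trace_def matrix_matrix_mult_def transpose_def power2_norm_eq_inner inner_vec_def)

lemma norm_matrix_vector_squared:
  fixes C :: "real^'n^'m"
  shows "(norm (C *v x))\<^sup>2 = (\<Sum>i\<in>UNIV. (C $ i \<bullet> x)\<^sup>2)"
  unfolding power2_norm_eq_inner inner_vec_def[of "C *v x"]
  by (simp add: matrix_vector_mul_component power2_eq_square)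

text \<open>For \<open>A\<close> with orthonormal columns, the orthogonal projection onto the
  complement of its range.\<close>

definition cproj :: "real^'n^'m \<Rightarrow> real^'m^'m" where
  "cproj A = mat 1 - A ** transpose A"

lemma cproj_vector: "cproj A *v x = x - A *v (transpose A *v x)"
  by (simp add: cproj_def matrix_vector_mult_diff_rdistrib matrix_vector_mul_assoc)

lemma transpose_cproj [simp]: "transpose (cproj A) = cproj A"
  by (simp add: cproj_def transpose_diff matrix_transpose_mul)

locale isometry_matrix =
  fixes A :: "real^'n^'m"
  assumes isometry: "transpose A ** A = mat 1"
begin

lemma transpose_mult_vector [simp]: "transpose A *v (A *v y) = y"
  by (simp add: matrix_vector_mul_assoc isometry)

lemma inner_isometry [simp]: "(A *v x) \<bullet> (A *v y) = x \<bullet> y"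
  by (simp add: inner_matrix_transpose)

lemma norm_isometry [simp]: "norm (A *v x) = norm x"
  by (simp add: norm_eq_sqrt_inner)

lemma cproj_isometry [simp]: "cproj A *v (A *v y) = 0"
  by (simp add: cproj_vector)

lemma transpose_cproj_vector [simp]: "transpose A *v (cproj A *v x) = 0"
  by (simp add: cproj_vector matrix_vector_mult_diff_distrib)

lemma inner_isometry_cproj [simp]: "(A *v y) \<bullet> (cproj A *v x) = 0"
  by (simp add: inner_matrix_transpose)

lemma norm_decompose: "(norm x)\<^sup>2 = (norm (transpose A *v x))\<^sup>2 + (norm (cproj A *v x))\<^sup>2"
proof -
  have x: "x = A *v (transpose A *v x) + cproj A *v x" by (simp add: cproj_vector)
  have "(norm x)\<^sup>2 = (norm (A *v (transpose A *v x) + cproj A *v x))\<^sup>2" using x by simp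
  also have "\<dots> = (norm (A *v (transpose A *v x)))\<^sup>2 + (norm (cproj A *v x))\<^sup>2"
    by (rule norm_add_Pythagorean) (simp add: orthogonal_def)
  finally show ?thesis by simp
qed

lemma norm_cproj_le: "(norm (cproj A *v x))\<^sup>2 \<le> (norm x)\<^sup>2"
  using norm_decompose[of x] by simp

lemma cproj_idem: "cproj A ** cproj A = cproj A"
proof -
  have "A ** transpose A ** (A ** transpose A) = A ** transpose A"
    by (metis isometry matrix_mul_assoc matrix_mul_rid)
  then show ?thesis by (simp add: cproj_def matrix_mult_diff_left matrix_mult_diff_right)
qed

lemma trace_range_proj: "trace (A ** transpose A) = CARD('n)"
  by (subst trace_mul_sym) (simp add: isometry trace_I)

text \<open>The reflection that fixes the range of \<open>A\<close> and negates its orthogonal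
  complement.\<close>

definition reflect :: "real^'m \<Rightarrow> real^'m" where
  "reflect x = A *v (transpose A *v x) - cproj A *v x"

lemma transpose_reflect [simp]: "transpose A *v reflect x = transpose A *v x"
  by (simp add: reflect_def matrix_vector_mult_diff_distrib)

lemma cproj_reflect [simp]: "cproj A *v reflect x = - (cproj A *v x)"
  by (simp add: reflect_def matrix_vector_mult_diff_distrib)
     (simp add: matrix_vector_mul_assoc cproj_idem)

lemma linear_reflect: "linear reflect"
  by (rule linearI)
     (simp_all add: reflect_def matrix_vector_right_distrib matrix_vector_mult_scaleR scaleR_diff_right)

lemma orthogonal_transformation_reflect: "orthogonal_transformation reflect"
proof -
  have "norm (reflect x) = norm x" for x
    by (rule power2_eq_imp_eq) (simp_all add: norm_decompose[of x] norm_decompose[of "reflect x"])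
  then show ?thesis by (simp add: orthogonal_transformation linear_reflect)
qed

text \<open>Pythagoras splits the squared distance to a mean in the range of \<open>A\<close>. The
  quotient of powers adjusts the normalising constant, since the two densities live in different
  dimensions.\<close>

lemma iso_normal_density_isometry:
  assumes "0 < v"
  shows "iso_normal_density (A *v m) v x
    = (1 / sqrt (2 * pi * v)) ^ CARD('m) / (1 / sqrt (2 * pi * v)) ^ CARD('n)
      * exp (- (norm (cproj A *v x))\<^sup>2 / (2 * v)) * iso_normal_density m v (transpose A *v x)"
proof -
  have "(norm (x - A *v m))\<^sup>2 = (norm (transpose A *v x - m))\<^sup>2 + (norm (cproj A *v x))\<^sup>2"
    using norm_decompose[of "x - A *v m"] by (simp add: matrix_vector_mult_diff_distrib)
  then have "- (norm (x - A *v m))\<^sup>2 / (2 * v)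
      = - (norm (cproj A *v x))\<^sup>2 / (2 * v) + - (norm (transpose A *v x - m))\<^sup>2 / (2 * v)"
    using assms by (simp add: field_simps)
  then have "exp (- (norm (x - A *v m))\<^sup>2 / (2 * v))
      = exp (- (norm (cproj A *v x))\<^sup>2 / (2 * v)) * exp (- (norm (transpose A *v x - m))\<^sup>2 / (2 * v))"
    by (simp only: exp_add)
  then show ?thesis using assms by (simp add: iso_normal_density_eq field_simps)
qed

lemma iso_normal_density_reflect:
  assumes "0 < v"
  shows "iso_normal_density (A *v m) v (reflect x) = iso_normal_density (A *v m) v x"
  using assms by (simp add: iso_normal_density_isometry)

end

text \<open>Cyclicity of the trace and idempotence of the projections reduce both traces to those of
  the two range projections, which are the numbers of columns, and to the trace of their product,
  which is \<open>\<tau>\<close>.\<close>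

lemma
  fixes A :: "real^'n^'D" and V :: "real^'m^'D"
  assumes A: "isometry_matrix A" and V: "isometry_matrix V"
  defines "\<tau> \<equiv> trace (transpose (transpose V ** A) ** (transpose V ** A))"
  shows trace_cproj_range: "trace ((cproj V ** A) ** transpose (cproj V ** A)) = real CARD('n) - \<tau>"
    and trace_cproj_cproj: "trace ((cproj V ** cproj A) ** transpose (cproj V ** cproj A))
      = real CARD('D) - real CARD('m) - real CARD('n) + \<tau>"
proof -
  interpret A: isometry_matrix A by (rule A)
  interpret V: isometry_matrix V by (rule V)
  have "trace ((V ** transpose V) ** (A ** transpose A)) = trace ((V ** transpose V ** A) ** transpose A)"
    by (simp add: matrix_mul_assoc)
  also have "\<dots> = trace (transpose A ** (V ** transpose V ** A))" by (rule trace_mul_sym)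
  also have "\<dots> = \<tau>" by (simp add: \<tau>_def matrix_transpose_mul matrix_mul_assoc)
  finally have \<tau>: "trace ((V ** transpose V) ** (A ** transpose A)) = \<tau>" .
  have "trace ((cproj V ** A) ** transpose (cproj V ** A)) = trace (cproj V ** (A ** transpose A ** cproj V))"
    by (simp add: matrix_transpose_mul matrix_mul_assoc)
  also have "\<dots> = trace (A ** transpose A ** (cproj V ** cproj V))"
    by (subst trace_mul_sym) (simp add: matrix_mul_assoc)
  also have "\<dots> = trace (cproj V ** (A ** transpose A))"
    by (subst trace_mul_sym) (simp add: V.cproj_idem)
  also have "\<dots> = real CARD('n) - \<tau>"
    by (simp add: cproj_def matrix_mult_diff_left trace_sub A.trace_range_proj \<tau>)
  finally show 1: "trace ((cproj V ** A) ** transpose (cproj V ** A)) = real CARD('n) - \<tau>" .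
  have "trace ((cproj V ** cproj A) ** transpose (cproj V ** cproj A))
      = trace (cproj V ** (cproj A ** cproj A ** cproj V))"
    by (simp add: matrix_transpose_mul matrix_mul_assoc)
  also have "\<dots> = trace (cproj A ** (cproj V ** cproj V))"
    by (subst trace_mul_sym) (simp add: matrix_mul_assoc A.cproj_idem)
  also have "\<dots> = trace (cproj A ** cproj V)" by (simp add: V.cproj_idem)
  also have "\<dots> = trace (cproj V ** cproj A)" by (rule trace_mul_sym)
  also have "\<dots> = real CARD('D) - real CARD('m) - (real CARD('n) - \<tau>)"
    by (simp add: cproj_def matrix_mult_diff_left matrix_mult_diff_right trace_sub trace_I
        A.trace_range_proj V.trace_range_proj \<tau>)
  finally show "trace ((cproj V ** cproj A) ** transpose (cproj V ** cproj A))
      = real CARD('D) - real CARD('m) - real CARD('n) + \<tau>" by simp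
qed

subsection \<open>Gaussian mixtures and their scores\<close>

text \<open>The kernel is bounded and positive, so it is integrable and its mean over a probability
  measure cannot vanish. Positivity is what makes the logarithm of a mixture differentiable.\<close>

lemma ennreal_normal_mixture:
  fixes m :: "'c \<Rightarrow> 'a::euclidean_space"
  assumes N: "prob_space N" and m [measurable]: "m \<in> borel_measurable N" and v: "0 < v"
  shows "ennreal (\<integral>z. iso_normal_density (m z) v x \<partial>N) = (\<integral>\<^sup>+z. ennreal (iso_normal_density (m z) v x) \<partial>N)"
    and "0 < (\<integral>z. iso_normal_density (m z) v x \<partial>N)"
proof -
  interpret prob_space N by (rule N)
  have int: "integrable N (\<lambda>z. iso_normal_density (m z) v x)"
  proof (rule integrable_const_bound)
    show "AE z in N. norm (iso_normal_density (m z) v x) \<le> (1 / sqrt (2 * pi * v)) ^ DIM('a)"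
      by (intro AE_I2) (simp add: iso_normal_density_nonneg iso_normal_density_le[OF v])
  qed measurable
  then show "ennreal (\<integral>z. iso_normal_density (m z) v x \<partial>N) = (\<integral>\<^sup>+z. ennreal (iso_normal_density (m z) v x) \<partial>N)"
    by (intro nn_integral_eq_integral[symmetric]) (simp_all add: iso_normal_density_nonneg)
  have "(\<integral>z. iso_normal_density (m z) v x \<partial>N) \<noteq> 0"
  proof
    assume "(\<integral>z. iso_normal_density (m z) v x \<partial>N) = 0"
    then have "AE z in N. iso_normal_density (m z) v x = 0"
      using int by (subst (asm) integral_nonneg_eq_0_iff_AE) (simp_all add: iso_normal_density_nonneg)
    then have "AE z in N. False"
      by eventually_elim (use iso_normal_density_pos[OF v] in \<open>metis less_irrefl\<close>)
    then show False by simp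
  qed
  moreover have "0 \<le> (\<integral>z. iso_normal_density (m z) v x \<partial>N)"
    by (simp add: iso_normal_density_nonneg)
  ultimately show "0 < (\<integral>z. iso_normal_density (m z) v x \<partial>N)" by simp
qed

text \<open>The chain rule gives the gradient as an explicit quotient of integrals over
  \<open>N\<close>; measurability in \<open>y\<close> is read off from this formula.\<close>

lemma GDERIV_ln_normal_mixture:
  fixes m :: "'c \<Rightarrow> 'a::euclidean_space"
  assumes N: "prob_space N" and m: "m \<in> borel_measurable N" and v: "0 < v"
  shows "GDERIV (\<lambda>y. ln (\<integral>z. iso_normal_density (m z) v y \<partial>N)) y
    :> gradient (\<lambda>y. ln (\<integral>z. iso_normal_density (m z) v y \<partial>N)) y" (is "GDERIV ?L y :> _")
    and "gradient (\<lambda>y. ln (\<integral>z. iso_normal_density (m z) v y \<partial>N)) \<in> borel_measurable borel"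
proof -
  interpret prob_space N by (rule N)
  note [measurable] = m
  define G where "G y = (1 / (\<integral>z. iso_normal_density (m z) v y \<partial>N)) *\<^sub>R
    (\<integral>z. (iso_normal_density (m z) v y / v) *\<^sub>R (m z - y) \<partial>N)" for y
  have G: "GDERIV ?L y :> G y" for y
    unfolding G_def
    by (rule GDERIV_DERIV_compose[OF GDERIV_normal_mixture[OF N m v]])
       (use ennreal_normal_mixture(2)[OF N m v] in \<open>auto intro!: derivative_eq_intros simp: field_simps\<close>)
  then have eq: "gradient ?L = G" by (intro ext gradient_eqI)
  then show "GDERIV ?L y :> gradient ?L y" using G by simp
  show "gradient ?L \<in> borel_measurable borel"
    unfolding eq G_def by measurable
qed

text \<open>The symmetry \<open>R\<close> exchanges \<open>a + b\<close> and \<open>a - b\<close>,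
  so their squared norms have equal integrals, and the parallelogram law evaluates the sum. No mixed
  term is ever integrated, so infinite values are covered.\<close>

lemma nn_integral_norm_add_odd:
  fixes a b :: "'c \<Rightarrow> 'e::{real_inner, second_countable_topology}"
  assumes inv: "\<And>u. u \<in> borel_measurable M \<Longrightarrow> (\<integral>\<^sup>+x. u (R x) \<partial>M) = (\<integral>\<^sup>+x. u x \<partial>M)"
    and [measurable]: "a \<in> borel_measurable M" "b \<in> borel_measurable M"
    and R: "\<And>x. a (R x) = a x" "\<And>x. b (R x) = - b x"
  shows "(\<integral>\<^sup>+x. ennreal ((norm (a x + b x))\<^sup>2) \<partial>M)
    = (\<integral>\<^sup>+x. ennreal ((norm (a x))\<^sup>2) \<partial>M) + (\<integral>\<^sup>+x. ennreal ((norm (b x))\<^sup>2) \<partial>M)" (is "?I = ?Ia + ?Ib")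
proof -
  have "(\<integral>\<^sup>+x. ennreal ((norm (a x - b x))\<^sup>2) \<partial>M) = ?I"
    using inv[of "\<lambda>x. ennreal ((norm (a x + b x))\<^sup>2)"] by (simp add: R)
  then have "?I + ?I = (\<integral>\<^sup>+x. ennreal ((norm (a x + b x))\<^sup>2) \<partial>M) + (\<integral>\<^sup>+x. ennreal ((norm (a x - b x))\<^sup>2) \<partial>M)"
    by simp
  also have "\<dots> = (\<integral>\<^sup>+x. ennreal ((norm (a x + b x))\<^sup>2) + ennreal ((norm (a x - b x))\<^sup>2) \<partial>M)"
    by (rule nn_integral_add[symmetric]) measurable
  also have "\<dots> = (\<integral>\<^sup>+x. 2 * (ennreal ((norm (a x))\<^sup>2) + ennreal ((norm (b x))\<^sup>2)) \<partial>M)"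
  proof (rule nn_integral_cong)
    fix x
    have "(norm (a x + b x))\<^sup>2 + (norm (a x - b x))\<^sup>2 = 2 * ((norm (a x))\<^sup>2 + (norm (b x))\<^sup>2)"
      by (simp add: power2_norm_eq_inner inner_add_left inner_add_right inner_diff_left inner_diff_right inner_commute)
    from arg_cong[OF this, of ennreal]
    show "ennreal ((norm (a x + b x))\<^sup>2) + ennreal ((norm (a x - b x))\<^sup>2)
        = 2 * (ennreal ((norm (a x))\<^sup>2) + ennreal ((norm (b x))\<^sup>2))"
      by (simp add: ennreal_mult ennreal_plus)
  qed
  also have "\<dots> = 2 * (?Ia + ?Ib)"
    by (simp add: nn_integral_cmult nn_integral_add)
  finally have "2 * ?I = 2 * (?Ia + ?Ib)" by (simp add: mult_2)
  then show ?thesis by (subst (asm) ennreal_mult_cancel_left) auto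
qed

context isometry_matrix
begin

text \<open>For fixed \<open>z\<close>, recentring at the mean \<open>A *v m z\<close> leaves
  \<open>C *v x\<close> unchanged because \<open>C\<close> annihilates the range of
  \<open>A\<close>. The inner integral is then a sum of second moments over the rows of
  \<open>C\<close>, the same for every \<open>z\<close>.\<close>

lemma nn_integral_cproj_normal_mixture:
  fixes C :: "real^'m^'k"
  assumes N: "prob_space N" and m [measurable]: "m \<in> borel_measurable N" and v: "0 < v"
    and p: "\<And>x. ennreal (p x) = (\<integral>\<^sup>+z. ennreal (iso_normal_density (A *v m z) v x) \<partial>N)"
    and C: "\<And>y. C *v (A *v y) = 0"
  shows "(\<integral>\<^sup>+x. ennreal (p x) * ennreal ((norm (C *v x))\<^sup>2) \<partial>lborel) = ennreal (v * trace (C ** transpose C))"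
proof -
  interpret prob_space N by (rule N)
  interpret pair_sigma_finite lborel N ..
  have [measurable]: "(\<lambda>x. M *v x) \<in> borel_measurable borel" for M :: "real^'i^'j"
    by (intro borel_measurable_continuous_onI linear_continuous_on matrix_vector_mul_bounded_linear)
  have "(\<integral>\<^sup>+x. ennreal (p x) * ennreal ((norm (C *v x))\<^sup>2) \<partial>lborel)
      = (\<integral>\<^sup>+x. \<integral>\<^sup>+z. ennreal (iso_normal_density (A *v m z) v x) * ennreal ((norm (C *v x))\<^sup>2) \<partial>N \<partial>lborel)"
    unfolding p by (intro nn_integral_cong nn_integral_multc[symmetric]) measurable
  also have "\<dots> = (\<integral>\<^sup>+z. \<integral>\<^sup>+x. ennreal (iso_normal_density (A *v m z) v x) * ennreal ((norm (C *v x))\<^sup>2) \<partial>lborel \<partial>N)"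
    by (rule Fubini'[symmetric]) measurable
  also have "\<dots> = (\<integral>\<^sup>+z. ennreal (v * trace (C ** transpose C)) \<partial>N)"
  proof (rule nn_integral_cong)
    fix z
    have "(\<integral>\<^sup>+x. ennreal (iso_normal_density (A *v m z) v x) * ennreal ((norm (C *v x))\<^sup>2) \<partial>lborel)
       = (\<integral>\<^sup>+x. ennreal (iso_normal_density (A *v m z) v (x + A *v m z)) * ennreal ((norm (C *v (x + A *v m z)))\<^sup>2) \<partial>lborel)"
      by (rule nn_integral_lborel_translate[symmetric]) measurable
    also have "\<dots> = (\<integral>\<^sup>+x. (\<Sum>i\<in>UNIV. ennreal ((C $ i \<bullet> x)\<^sup>2 * iso_normal_density 0 v x)) \<partial>lborel)"
      using v by (intro nn_integral_cong)
        (simp add: iso_normal_density_eq matrix_vector_right_distrib C norm_matrix_vector_squared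
          sum_distrib_right mult.commute sum_nonneg flip: ennreal_mult)
    also have "\<dots> = (\<Sum>i\<in>UNIV. \<integral>\<^sup>+x. ennreal ((C $ i \<bullet> x)\<^sup>2 * iso_normal_density 0 v x) \<partial>lborel)"
      by (rule nn_integral_sum) measurable
    also have "\<dots> = ennreal (v * trace (C ** transpose C))"
      using v by (simp add: nn_integral_iso_normal_second_moment trace_mult_transpose sum_distrib_left)
    finally show "(\<integral>\<^sup>+x. ennreal (iso_normal_density (A *v m z) v x) * ennreal ((norm (C *v x))\<^sup>2) \<partial>lborel)
       = ennreal (v * trace (C ** transpose C))" .
  qed
  also have "\<dots> = ennreal (v * trace (C ** transpose C))" by (simp add: emeasure_space_1)
  finally show ?thesis .
qed

end

text \<open>Each row \<open>C $ i\<close> contributes the quadratic form of \<open>S\<close> at that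
  row, which is at least \<open>lambda_min S\<close> times its squared norm.\<close>

lemma nn_integral_second_moment_ge:
  fixes g :: "'c \<Rightarrow> real^'n" and C :: "real^'n^'k"
  assumes int: "\<And>i j. integrable M (\<lambda>x. g x $ i * g x $ j)"
  defines "S \<equiv> (\<chi> i j. \<integral>x. g x $ i * g x $ j \<partial>M) :: real^'n^'n"
  shows "ennreal (lambda_min S * trace (C ** transpose C)) \<le> (\<integral>\<^sup>+x. ennreal ((norm (C *v g x))\<^sup>2) \<partial>M)"
proof -
  have sym: "transpose S = S" by (simp add: S_def vec_eq_iff transpose_def mult.commute)
  have sq: "(c \<bullet> g x)\<^sup>2 = (\<Sum>i\<in>UNIV. \<Sum>j\<in>UNIV. c $ i * c $ j * (g x $ i * g x $ j))" for c x
    by (simp add: inner_vec_def power2_eq_square sum_product mult_ac)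
  have int_sq: "integrable M (\<lambda>x. (c \<bullet> g x)\<^sup>2)" for c
    unfolding sq by (intro Bochner_Integration.integrable_sum integrable_mult_right int)
  have eq: "(\<integral>x. (c \<bullet> g x)\<^sup>2 \<partial>M) = c \<bullet> (S *v c)" for c
  proof -
    have "(\<integral>x. (c \<bullet> g x)\<^sup>2 \<partial>M) = (\<Sum>i\<in>UNIV. \<Sum>j\<in>UNIV. c $ i * c $ j * S $ i $ j)"
      unfolding sq S_def by (simp add: Bochner_Integration.integral_sum int)
    also have "\<dots> = c \<bullet> (S *v c)"
      by (simp add: inner_vec_def matrix_vector_mult_def sum_distrib_left mult_ac)
    finally show ?thesis .
  qed
  have "lambda_min S * trace (C ** transpose C) = (\<Sum>i\<in>UNIV. lambda_min S * (C $ i \<bullet> C $ i))"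
    by (simp add: trace_mult_transpose sum_distrib_left power2_norm_eq_inner)
  also have "\<dots> \<le> (\<Sum>i\<in>UNIV. \<integral>x. (C $ i \<bullet> g x)\<^sup>2 \<partial>M)"
    unfolding eq by (intro sum_mono lambda_min_le_quadratic_form sym)
  also have "\<dots> = (\<integral>x. (norm (C *v g x))\<^sup>2 \<partial>M)"
    unfolding norm_matrix_vector_squared by (rule Bochner_Integration.integral_sum[symmetric]) (rule int_sq)
  finally have le: "lambda_min S * trace (C ** transpose C) \<le> (\<integral>x. (norm (C *v g x))\<^sup>2 \<partial>M)" .
  have "integrable M (\<lambda>x. (norm (C *v g x))\<^sup>2)"
    unfolding norm_matrix_vector_squared by (intro Bochner_Integration.integrable_sum int_sq)
  then have "ennreal (\<integral>x. (norm (C *v g x))\<^sup>2 \<partial>M) = (\<integral>\<^sup>+x. ennreal ((norm (C *v g x))\<^sup>2) \<partial>M)"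
    by (intro nn_integral_eq_integral[symmetric]) simp_all
  with le show ?thesis by (metis ennreal_leI)
qed

section \<open>The forward density as a Gaussian mixture\<close>

lemma htilde_pos: "0 < t \<Longrightarrow> 0 < htilde \<sigma> t"
  by (simp add: htilde_def add_nonneg_pos hvar_pos)

text \<open>\<open>ennreal\<close> cuts negative reals off at zero, so for summands of arbitrary
  sign it is only subadditive. This direction suffices for splitting the two terms of the lower
  bound.\<close>

lemma ennreal_add_le: "ennreal (a + b) \<le> ennreal a + ennreal b"
proof -
  have "ennreal (a + b) \<le> ennreal (max 0 a + max 0 b)" by (rule ennreal_leI) simp
  also have "\<dots> = ennreal a + ennreal b"
    by simp
  finally show ?thesis .
qed

text \<open>The library's \<open>indep_var_distribution_eq\<close> requires both variables to have the same
  type.\<close>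

lemma (in prob_space) distr_pair_indep_set:
  assumes [measurable]: "X \<in> measurable M S" "Y \<in> measurable M T"
    and ind: "indep_set (sets (vimage_algebra (space M) X S)) (sets (vimage_algebra (space M) Y T))"
  shows "distr M S X \<Otimes>\<^sub>M distr M T Y = distr M (S \<Otimes>\<^sub>M T) (\<lambda>\<omega>. (X \<omega>, Y \<omega>))"
proof (rule pair_measure_eqI)
  show "sigma_finite_measure (distr M S X)" "sigma_finite_measure (distr M T Y)"
    by (intro finite_measure.axioms(1) prob_space.axioms(1) prob_space_distr; simp)+
  fix A B assume "A \<in> sets (distr M S X)" "B \<in> sets (distr M T Y)"
  then have [measurable]: "A \<in> sets S" "B \<in> sets T" by auto
  have "X -` A \<inter> space M \<in> sets (vimage_algebra (space M) X S)"
    "Y -` B \<inter> space M \<in> sets (vimage_algebra (space M) Y T)"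
    by (auto intro: in_vimage_algebra)
  from indep_setD[OF ind this]
  have "prob (X -` A \<inter> space M) * prob (Y -` B \<inter> space M) = prob ((\<lambda>\<omega>. (X \<omega>, Y \<omega>)) -` (A \<times> B) \<inter> space M)"
    by (simp add: vimage_Times Int_ac comp_def)
  then show "emeasure (distr M S X) A * emeasure (distr M T Y) B
      = emeasure (distr M (S \<Otimes>\<^sub>M T) (\<lambda>\<omega>. (X \<omega>, Y \<omega>))) (A \<times> B)"
    by (simp add: emeasure_distr emeasure_eq_measure flip: ennreal_mult)
qed simp

text \<open>Independence turns the joint law into a product, and for a fixed latent value the data
  noise is integrated out by Gaussian convolution, which adds its scaled variance to
  \<open>hvar t\<close>.\<close>

lemma ennreal_forward_density_mixture:
  fixes A :: "real^'n^'m" and z :: "'a \<Rightarrow> real^'n" and e :: "'a \<Rightarrow> real^'m"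
  assumes P: "prob_space P" and z: "distributed P lborel z pz"
    and e: "distributed P lborel e (iso_normal_density 0 (\<sigma>\<^sup>2))" and \<sigma>: "0 < \<sigma>"
    and ind: "prob_space.indep_set P
           (sets (vimage_algebra (space P) z borel)) (sets (vimage_algebra (space P) e borel))"
    and p: "p = distr P borel (\<lambda>\<omega>. A *v z \<omega> + e \<omega>)" and t: "0 < t"
  shows "ennreal (forward_density p t x)
    = (\<integral>\<^sup>+y. ennreal (iso_normal_density (A *v (alpha t *\<^sub>R y)) (htilde \<sigma> t) x) \<partial>density lborel pz)"
proof -
  interpret prob_space P by (rule P)
  have [measurable]: "z \<in> borel_measurable P" "e \<in> borel_measurable P"
    using z e by (auto simp: distributed_def)
  have [measurable]: "(\<lambda>x. A *v x) \<in> borel_measurable borel"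
    by (intro borel_measurable_continuous_onI linear_continuous_on matrix_vector_mul_bounded_linear)
  have joint: "distr P (borel \<Otimes>\<^sub>M borel) (\<lambda>\<omega>. (z \<omega>, e \<omega>)) = distr P borel z \<Otimes>\<^sub>M distr P borel e"
    by (rule distr_pair_indep_set[symmetric]) (use ind in simp_all)
  \<comment> \<open>\<open>distributed\<close> refers to \<open>lborel\<close>; a pushforward
    depends on its target only through the sigma-algebra, so \<open>borel\<close> may replace
    it.\<close>
  have dz: "distr P borel z = density lborel pz" and de: "distr P borel e = density lborel (iso_normal_density 0 (\<sigma>\<^sup>2))"
    using distributed_distr_eq_density[OF z] distributed_distr_eq_density[OF e]
    by (simp_all cong: distr_cong)
  interpret Z: prob_space "distr P borel z" by (rule prob_space_distr) simp
  interpret E: prob_space "distr P borel e" by (rule prob_space_distr) simp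
  have "prob_space p" unfolding p by (rule prob_space_distr) simp
  moreover have "(\<lambda>x0. alpha t *\<^sub>R x0) \<in> borel_measurable p" unfolding p by simp
  ultimately have "ennreal (forward_density p t x)
      = (\<integral>\<^sup>+x0. ennreal (iso_normal_density (alpha t *\<^sub>R x0) (hvar t) x) \<partial>p)"
    unfolding forward_density_def using t by (intro ennreal_normal_mixture(1) hvar_pos)
  also have "\<dots> = (\<integral>\<^sup>+\<omega>. ennreal (iso_normal_density (alpha t *\<^sub>R (A *v z \<omega> + e \<omega>)) (hvar t) x) \<partial>P)"
    unfolding p by (rule nn_integral_distr) measurable
  also have "\<dots> = (\<integral>\<^sup>+ye. ennreal (iso_normal_density (alpha t *\<^sub>R (A *v fst ye + snd ye)) (hvar t) x)
      \<partial>distr P (borel \<Otimes>\<^sub>M borel) (\<lambda>\<omega>. (z \<omega>, e \<omega>)))"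
    by (subst nn_integral_distr) simp_all
  also have "\<dots> = (\<integral>\<^sup>+y. \<integral>\<^sup>+u. ennreal (iso_normal_density (alpha t *\<^sub>R (A *v y + u)) (hvar t) x)
      \<partial>distr P borel e \<partial>distr P borel z)"
    unfolding joint by (subst E.nn_integral_fst[symmetric]) simp_all
  also have "\<dots> = (\<integral>\<^sup>+y. ennreal (iso_normal_density (A *v (alpha t *\<^sub>R y)) (htilde \<sigma> t) x) \<partial>distr P borel z)"
  proof (rule nn_integral_cong)
    fix y
    have "(\<integral>\<^sup>+u. ennreal (iso_normal_density (alpha t *\<^sub>R (A *v y + u)) (hvar t) x) \<partial>distr P borel e)
      = (\<integral>\<^sup>+u. ennreal (iso_normal_density (alpha t *\<^sub>R (A *v y + u)) (hvar t) x
          * iso_normal_density 0 (\<sigma>\<^sup>2) u) \<partial>lborel)"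
      unfolding de by (subst nn_integral_density)
        (simp_all add: ennreal_mult iso_normal_density_nonneg mult.commute)
    also have "\<dots> = ennreal (iso_normal_density (alpha t *\<^sub>R (A *v y)) ((alpha t)\<^sup>2 * \<sigma>\<^sup>2 + hvar t) x)"
      using t \<sigma> by (intro nn_integral_iso_normal_density_conv_scaled hvar_pos) (simp_all add: alpha_def)
    finally show "(\<integral>\<^sup>+u. ennreal (iso_normal_density (alpha t *\<^sub>R (A *v y + u)) (hvar t) x) \<partial>distr P borel e)
      = ennreal (iso_normal_density (A *v (alpha t *\<^sub>R y)) (htilde \<sigma> t) x)"
      by (simp add: htilde_def matrix_vector_mult_scaleR)
  qed
  finally show ?thesis unfolding dz .
qed

text \<open>Moving \<open>pz\<close> into the measure brings the latent density into the form to
  which the results on Gaussian mixtures apply.\<close>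

lemma ld_density_eq_mixture:
  assumes "\<And>z. 0 \<le> pz z" and "pz \<in> borel_measurable borel"
  shows "ld_density \<sigma> pz t y
    = (\<integral>z. iso_normal_density (alpha t *\<^sub>R z) (htilde \<sigma> t) y \<partial>density lborel pz)"
  unfolding ld_density_def using assms by (subst integral_density) (simp_all add: mult.commute)

context isometry_matrix
begin

text \<open>Up to a constant, the log density is the latent log density at
  \<open>transpose A *v x\<close> minus the squared norm of \<open>cproj A *v x\<close> over
  \<open>2 * v\<close>. The chain rule brings in \<open>A\<close> as the adjoint of
  \<open>transpose A\<close>, and symmetry and idempotence of \<open>cproj A\<close> give the linear
  term.\<close>

lemma gradient_ln_normal_mixture_isometry:
  fixes c :: "'c \<Rightarrow> real^'n"
  assumes N: "prob_space N" and c: "c \<in> borel_measurable N" and v: "0 < v"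
    and p: "\<And>x. ennreal (p x) = (\<integral>\<^sup>+z. ennreal (iso_normal_density (A *v c z) v x) \<partial>N)"
    and p0: "\<And>x. 0 \<le> p x"
  shows "gradient (\<lambda>x. ln (p x)) x
    = A *v gradient (\<lambda>y. ln (\<integral>z. iso_normal_density (c z) v y \<partial>N)) (transpose A *v x)
      - (1 / v) *\<^sub>R (cproj A *v x)"
proof (rule gradient_eqI)
  define K where "K = (1 / sqrt (2 * pi * v)) ^ CARD('m) / (1 / sqrt (2 * pi * v)) ^ CARD('n)"
  have K: "0 < K" using v by (simp add: K_def)
  define F where "F y = (\<integral>z. iso_normal_density (c z) v y \<partial>N)" for y
  have F: "0 < F y" for y unfolding F_def by (rule ennreal_normal_mixture(2)[OF N c v])
  have "p x = K * exp (- (norm (cproj A *v x))\<^sup>2 / (2 * v)) * F (transpose A *v x)" for x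
  proof -
    have [measurable]: "c \<in> borel_measurable N" by (rule c)
    have "ennreal (p x) = (\<integral>\<^sup>+z. ennreal (K * exp (- (norm (cproj A *v x))\<^sup>2 / (2 * v)))
        * ennreal (iso_normal_density (c z) v (transpose A *v x)) \<partial>N)"
      unfolding p iso_normal_density_isometry[OF v] K_def[symmetric]
      using K by (intro nn_integral_cong ennreal_mult) (simp_all add: iso_normal_density_nonneg)
    also have "\<dots> = ennreal (K * exp (- (norm (cproj A *v x))\<^sup>2 / (2 * v)) * F (transpose A *v x))"
      using K F by (simp add: nn_integral_cmult ennreal_normal_mixture(1)[OF N c v, symmetric]
          F_def[symmetric] less_imp_le ennreal_mult)
    finally show ?thesis using p0 K F by (subst (asm) ennreal_inj) (auto simp: less_imp_le)
  qed
  then have ln_p: "(\<lambda>x. ln (p x))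
      = (\<lambda>x. ln K - ((cproj A *v x) \<bullet> (cproj A *v x)) / (2 * v) + ln (F (transpose A *v x)))"
    using K F by (intro ext) (simp add: ln_mult power2_norm_eq_inner less_imp_neq[symmetric])
  have d1: "((\<lambda>x. M *v x) has_derivative (\<lambda>h. M *v h)) (at x)" for M :: "real^'i^'j" and x
    by (intro bounded_linear_imp_has_derivative matrix_vector_mul_bounded_linear)
  define S where "S = gradient (\<lambda>y. ln (F y)) (transpose A *v x)"
  have "((\<lambda>y. ln (F y)) has_derivative (\<lambda>h. h \<bullet> S)) (at (transpose A *v x))"
    using GDERIV_ln_normal_mixture(1)[OF N c v] by (simp add: gderiv_def F_def[abs_def] S_def)
  from has_derivative_compose[OF d1 this]
  have d2: "((\<lambda>x. ln (F (transpose A *v x))) has_derivative (\<lambda>h. (transpose A *v h) \<bullet> S)) (at x)" .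
  have "((\<lambda>x. ln (p x)) has_derivative (\<lambda>h. 0 - ((cproj A *v x) \<bullet> (cproj A *v h) + (cproj A *v h) \<bullet> (cproj A *v x)) / (2 * v)
      + (transpose A *v h) \<bullet> S)) (at x)"
    unfolding ln_p
    by (intro has_derivative_add has_derivative_diff has_derivative_const has_derivative_inner d1 d2
        bounded_linear.has_derivative[OF bounded_linear_divide])
  moreover have "0 - ((cproj A *v x) \<bullet> (cproj A *v h) + (cproj A *v h) \<bullet> (cproj A *v x)) / (2 * v)
      + (transpose A *v h) \<bullet> S = h \<bullet> (A *v S - (1 / v) *\<^sub>R (cproj A *v x))" for h
  proof -
    have "(cproj A *v h) \<bullet> (cproj A *v x) = h \<bullet> (cproj A *v x)"
      by (simp add: inner_matrix_transpose matrix_vector_mul_assoc cproj_idem)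
    moreover have "(transpose A *v h) \<bullet> S = h \<bullet> (A *v S)"
      by (metis inner_matrix_transpose transpose_transpose)
    ultimately show ?thesis by (simp add: inner_diff_right inner_commute[of "cproj A *v x"])
  qed
  ultimately show "GDERIV (\<lambda>x. ln (p x)) x :> A *v gradient (\<lambda>y. ln (\<integral>z. iso_normal_density (c z) v y \<partial>N)) (transpose A *v x)
      - (1 / v) *\<^sub>R (cproj A *v x)"
    by (simp add: gderiv_def S_def F_def[abs_def])
qed

text \<open>The reflection fixes the \<open>g\<close> term and negates the \<open>cproj A\<close>
  term, so the squared norm decouples under the integral. The first part is bounded through
  \<open>lambda_min S\<close>, the second is computed exactly.\<close>

lemma projected_risk_lower_bound:
  fixes c :: "'c \<Rightarrow> real^'n" and g :: "real^'n \<Rightarrow> real^'n" and Q :: "real^'m^'k"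
  assumes N: "prob_space N" and c [measurable]: "c \<in> borel_measurable N" and v: "0 < v"
    and p: "\<And>x. ennreal (p x) = (\<integral>\<^sup>+z. ennreal (iso_normal_density (A *v c z) v x) \<partial>N)"
    and g [measurable]: "g \<in> borel_measurable borel"
    and int: "\<And>i j. integrable (density lborel p) (\<lambda>x. g (transpose A *v x) $ i * g (transpose A *v x) $ j)"
  defines "S \<equiv> (\<chi> i j. \<integral>x. g (transpose A *v x) $ i * g (transpose A *v x) $ j \<partial>density lborel p) :: real^'n^'n"
  shows "ennreal (lambda_min S * trace ((Q ** A) ** transpose (Q ** A))
      + b\<^sup>2 * (v * trace ((Q ** cproj A) ** transpose (Q ** cproj A))))
    \<le> (\<integral>\<^sup>+x. ennreal ((norm (Q *v (A *v g (transpose A *v x) + b *\<^sub>R (cproj A *v x))))\<^sup>2) \<partial>density lborel p)"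
proof -
  interpret N: prob_space N by (rule N)
  have mv [measurable]: "(\<lambda>x. M *v x) \<in> borel_measurable borel" for M :: "real^'i^'j"
    by (intro borel_measurable_continuous_onI linear_continuous_on matrix_vector_mul_bounded_linear)
  have pm [measurable]: "(\<lambda>x. ennreal (p x)) \<in> borel_measurable borel"
    unfolding p by measurable
  \<comment> \<open>All component means lie in the range of \<open>A\<close>, so \<open>p\<close> is
    invariant under the reflection, and so is Lebesgue measure.\<close>
  have inv: "(\<integral>\<^sup>+x. u (reflect x) \<partial>density lborel p) = (\<integral>\<^sup>+x. u x \<partial>density lborel p)"
    if "u \<in> borel_measurable (density lborel p)" for u
  proof -
    have [measurable]: "u \<in> borel_measurable borel" using that by simp
    have [measurable]: "reflect \<in> borel_measurable borel"
      unfolding reflect_def[abs_def] by measurable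
    have "(\<integral>\<^sup>+x. u (reflect x) \<partial>density lborel p) = (\<integral>\<^sup>+x. ennreal (p (reflect x)) * u (reflect x) \<partial>lborel)"
      using v by (simp add: nn_integral_density p iso_normal_density_reflect)
    also have "\<dots> = (\<integral>\<^sup>+x. ennreal (p x) * u x \<partial>lborel)"
      by (rule nn_integral_orthogonal_transformation[OF orthogonal_transformation_reflect]) measurable
    finally show ?thesis by (simp add: nn_integral_density)
  qed
  have "(\<integral>\<^sup>+x. ennreal ((norm (Q *v (A *v g (transpose A *v x) + b *\<^sub>R (cproj A *v x))))\<^sup>2) \<partial>density lborel p)
    = (\<integral>\<^sup>+x. ennreal ((norm ((Q ** A) *v g (transpose A *v x) + b *\<^sub>R ((Q ** cproj A) *v x)))\<^sup>2) \<partial>density lborel p)"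
    by (simp add: matrix_vector_right_distrib matrix_vector_mult_scaleR flip: matrix_vector_mul_assoc)
  also have "\<dots> = (\<integral>\<^sup>+x. ennreal ((norm ((Q ** A) *v g (transpose A *v x)))\<^sup>2) \<partial>density lborel p)
      + (\<integral>\<^sup>+x. ennreal ((norm (b *\<^sub>R ((Q ** cproj A) *v x)))\<^sup>2) \<partial>density lborel p)"
    by (rule nn_integral_norm_add_odd[where R = reflect, OF inv])
       (measurable, simp_all flip: matrix_vector_mul_assoc add: linear_neg[OF matrix_vector_mul_linear])
  also have "(\<integral>\<^sup>+x. ennreal ((norm (b *\<^sub>R ((Q ** cproj A) *v x)))\<^sup>2) \<partial>density lborel p)
      = (\<integral>\<^sup>+x. ennreal (b\<^sup>2) * (ennreal (p x) * ennreal ((norm ((Q ** cproj A) *v x))\<^sup>2)) \<partial>lborel)"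
    by (simp add: nn_integral_density power_mult_distrib ennreal_mult mult_ac)
  also have "\<dots> = ennreal (b\<^sup>2) * ennreal (v * trace ((Q ** cproj A) ** transpose (Q ** cproj A)))"
    using nn_integral_cproj_normal_mixture[OF N c v p, where C = "Q ** cproj A"]
    by (simp add: nn_integral_cmult flip: matrix_vector_mul_assoc)
  also have "\<dots> = ennreal (b\<^sup>2 * (v * trace ((Q ** cproj A) ** transpose (Q ** cproj A))))"
    by (rule ennreal_mult'[symmetric]) simp
  finally have eq: "(\<integral>\<^sup>+x. ennreal ((norm (Q *v (A *v g (transpose A *v x) + b *\<^sub>R (cproj A *v x))))\<^sup>2) \<partial>density lborel p)
    = (\<integral>\<^sup>+x. ennreal ((norm ((Q ** A) *v g (transpose A *v x)))\<^sup>2) \<partial>density lborel p)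
      + ennreal (b\<^sup>2 * (v * trace ((Q ** cproj A) ** transpose (Q ** cproj A))))" .
  have "ennreal (lambda_min S * trace ((Q ** A) ** transpose (Q ** A))
      + b\<^sup>2 * (v * trace ((Q ** cproj A) ** transpose (Q ** cproj A))))
    \<le> ennreal (lambda_min S * trace ((Q ** A) ** transpose (Q ** A)))
      + ennreal (b\<^sup>2 * (v * trace ((Q ** cproj A) ** transpose (Q ** cproj A))))"
    by (rule ennreal_add_le)
  also have "\<dots> \<le> (\<integral>\<^sup>+x. ennreal ((norm ((Q ** A) *v g (transpose A *v x)))\<^sup>2) \<partial>density lborel p)
      + ennreal (b\<^sup>2 * (v * trace ((Q ** cproj A) ** transpose (Q ** cproj A))))"
    unfolding S_def using nn_integral_second_moment_ge[OF int] by (rule add_right_mono)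
  finally show ?thesis unfolding eq .
qed

end

text \<open>Here \<open>S\<close> stands for the latent score and \<open>u\<close> for the value of
  the network function. The difference of scores is \<open>V *v u - w\<close> divided by
  \<open>h\<close>; the contraction \<open>cproj V\<close> annihilates \<open>V *v u\<close>, so the
  bound is free of \<open>u\<close>.\<close>

lemma norm_structured_score_ge:
  assumes A: "isometry_matrix A" and V: "isometry_matrix V" and h: "0 < h" and v: "v \<noteq> 0"
  shows "(norm (cproj V *v (A *v (h *\<^sub>R S + transpose A *v x) + (1 - h / v) *\<^sub>R (cproj A *v x))))\<^sup>2 / h\<^sup>2
    \<le> (norm ((1 / h) *\<^sub>R (V *v u) - (1 / h) *\<^sub>R x - (A *v S - (1 / v) *\<^sub>R (cproj A *v x))))\<^sup>2"
proof -
  interpret A: isometry_matrix A by (rule A)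
  interpret V: isometry_matrix V by (rule V)
  define w where "w = A *v (h *\<^sub>R S + transpose A *v x) + (1 - h / v) *\<^sub>R (cproj A *v x)"
  have "x = A *v (transpose A *v x) + cproj A *v x" by (simp add: cproj_vector)
  then have "(1 / h) *\<^sub>R x = (1 / h) *\<^sub>R (A *v (transpose A *v x)) + (1 / h) *\<^sub>R (cproj A *v x)"
    by (metis scaleR_add_right)
  then have eq: "(1 / h) *\<^sub>R (V *v u) - (1 / h) *\<^sub>R x - (A *v S - (1 / v) *\<^sub>R (cproj A *v x))
      = (1 / h) *\<^sub>R (V *v u - w)"
    using h v unfolding w_def
    by (simp add: matrix_vector_right_distrib matrix_vector_mult_scaleR algebra_simps
        flip: scaleR_add_left)
  have "(norm (cproj V *v w))\<^sup>2 = (norm (cproj V *v (V *v u - w)))\<^sup>2"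
    by (simp add: matrix_vector_mult_diff_distrib)
  also have "\<dots> \<le> (norm (V *v u - w))\<^sup>2" by (rule V.norm_cproj_le)
  finally show ?thesis
    unfolding eq w_def[symmetric] using h by (simp add: power_mult_distrib power_divide divide_right_mono)
qed

subsection \<open>The risk of structured scores\<close>

text \<open>The projected bound with \<open>Q = cproj V\<close> and \<open>b = 1 - h / v\<close>,
  divided by \<open>h\<^sup>2\<close>. The left side does not mention \<open>f\<close>, so it
  survives the infimum over the class.\<close>

lemma score_risk_at_time_ge:
  fixes A :: "real^'n^'D" and V :: "real^'d^'D" and pz :: "real^'n \<Rightarrow> real"
    and g :: "real^'n \<Rightarrow> real^'n"
  assumes A: "isometry_matrix A" and V: "isometry_matrix V"
    and N: "prob_space (density lborel pz)" and pz: "\<And>z. 0 \<le> pz z" "pz \<in> borel_measurable borel"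
    and t: "0 < t"
    and law: "forward_law p t = density lborel (forward_density p t)"
    and mix: "\<And>x. ennreal (forward_density p t x)
      = (\<integral>\<^sup>+y. ennreal (iso_normal_density (A *v (alpha t *\<^sub>R y)) (htilde \<sigma> t) x) \<partial>density lborel pz)"
  defines "g \<equiv> \<lambda>y. hvar t *\<^sub>R gradient (\<lambda>y. ln (ld_density \<sigma> pz t y)) y + y"
  assumes int: "\<And>i j. integrable (forward_law p t) (\<lambda>x. g (transpose A *v x) $ i * g (transpose A *v x) $ j)"
  defines "S \<equiv> (\<chi> i j. \<integral>x. g (transpose A *v x) $ i * g (transpose A *v x) $ j \<partial>forward_law p t) :: real^'n^'n"
    and "\<tau> \<equiv> trace (transpose (transpose V ** A) ** (transpose V ** A))"
  shows "ennreal (lambda_min S / (hvar t)\<^sup>2 * (real CARD('n) - \<tau>)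
      + \<sigma> ^ 4 * alpha t ^ 4 / ((hvar t)\<^sup>2 * htilde \<sigma> t) * (real CARD('D) - real CARD('d) - real CARD('n) + \<tau>))
    \<le> (\<integral>\<^sup>+x. ennreal ((norm (structured_score V f x t - gradient (\<lambda>x. ln (forward_density p t x)) x))\<^sup>2)
          \<partial>forward_law p t)"
proof -
  interpret A: isometry_matrix A by (rule A)
  define h v where "h = hvar t" and "v = htilde \<sigma> t"
  have h: "0 < h" and v: "0 < v" using t by (simp_all add: h_def v_def hvar_pos htilde_pos)
  define G where "G = gradient (\<lambda>y. ln (ld_density \<sigma> pz t y))"
  have ld: "ld_density \<sigma> pz t
      = (\<lambda>y. \<integral>z. iso_normal_density (alpha t *\<^sub>R z) v y \<partial>density lborel pz)"
    unfolding v_def by (intro ext ld_density_eq_mixture pz)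
  have c: "(\<lambda>z. alpha t *\<^sub>R z) \<in> borel_measurable (density lborel pz)" by simp
  have G [measurable]: "G \<in> borel_measurable borel"
    unfolding G_def ld by (rule GDERIV_ln_normal_mixture(2)[OF N c v])
  have g [measurable]: "g \<in> borel_measurable borel"
    unfolding g_def G_def[symmetric] by measurable
  have mv [measurable]: "(\<lambda>x. M *v x) \<in> borel_measurable borel" for M :: "real^'i^'j"
    by (intro borel_measurable_continuous_onI linear_continuous_on matrix_vector_mul_bounded_linear)
  define b where "b = 1 - h / v"
  define r where "r x = (norm (cproj V *v (A *v g (transpose A *v x) + b *\<^sub>R (cproj A *v x))))\<^sup>2" for x
  have [measurable]: "r \<in> borel_measurable borel" unfolding r_def by measurable
  have score: "gradient (\<lambda>x. ln (forward_density p t x)) x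
      = A *v G (transpose A *v x) - (1 / v) *\<^sub>R (cproj A *v x)" for x
    unfolding G_def ld
  proof (rule A.gradient_ln_normal_mixture_isometry[OF N c v])
    show "0 \<le> forward_density p t x" for x
      by (simp add: forward_density_def iso_normal_density_nonneg)
  qed (simp add: mix v_def)
  have le: "r x / h\<^sup>2 \<le> (norm (structured_score V f x t - gradient (\<lambda>x. ln (forward_density p t x)) x))\<^sup>2" for x
    using norm_structured_score_ge[OF A V h, of v "G (transpose A *v x)" x "f (transpose V *v x) t"] v
    unfolding r_def score structured_score_def h_def[symmetric] b_def g_def G_def by simp
  \<comment> \<open>Since \<open>v - h\<close> equals
    \<open>(alpha t)\<^sup>2 * \<sigma>\<^sup>2\<close>, this is the source of the coefficient in
    front of the second trace.\<close>
  have b2: "b\<^sup>2 * v = \<sigma> ^ 4 * alpha t ^ 4 / v"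
  proof -
    have "b = (alpha t)\<^sup>2 * \<sigma>\<^sup>2 / v"
      using v by (simp add: b_def h_def v_def htilde_def field_simps)
    then show ?thesis using v by (simp add: power2_eq_square power4_eq_xxxx)
  qed
  have "lambda_min S / h\<^sup>2 * (real CARD('n) - \<tau>)
      + \<sigma> ^ 4 * alpha t ^ 4 / (h\<^sup>2 * v) * (real CARD('D) - real CARD('d) - real CARD('n) + \<tau>)
    = (1 / h\<^sup>2) * (lambda_min S * trace ((cproj V ** A) ** transpose (cproj V ** A))
      + b\<^sup>2 * (v * trace ((cproj V ** cproj A) ** transpose (cproj V ** cproj A))))"
    unfolding trace_cproj_range[OF A V] trace_cproj_cproj[OF A V] \<tau>_def[symmetric]
      mult.assoc[symmetric] b2
    by (simp add: distrib_left)
  then have "ennreal (lambda_min S / h\<^sup>2 * (real CARD('n) - \<tau>)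
      + \<sigma> ^ 4 * alpha t ^ 4 / (h\<^sup>2 * v) * (real CARD('D) - real CARD('d) - real CARD('n) + \<tau>))
    = ennreal (1 / h\<^sup>2) * ennreal (lambda_min S * trace ((cproj V ** A) ** transpose (cproj V ** A))
      + b\<^sup>2 * (v * trace ((cproj V ** cproj A) ** transpose (cproj V ** cproj A))))"
    by (simp add: ennreal_mult' del: times_divide_eq_left)
  also have "\<dots> \<le> ennreal (1 / h\<^sup>2) * (\<integral>\<^sup>+x. ennreal (r x) \<partial>density lborel (forward_density p t))"
    unfolding S_def law r_def
    by (intro mult_left_mono A.projected_risk_lower_bound[OF N c v] g) (use int in \<open>simp_all add: mix v_def law\<close>)
  also have "\<dots> = (\<integral>\<^sup>+x. ennreal (r x / h\<^sup>2) \<partial>forward_law p t)"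
    unfolding law by (subst nn_integral_cmult[symmetric]) (simp_all flip: ennreal_mult')
  also have "\<dots> \<le> (\<integral>\<^sup>+x. ennreal ((norm (structured_score V f x t - gradient (\<lambda>x. ln (forward_density p t x)) x))\<^sup>2)
          \<partial>forward_law p t)"
    by (intro nn_integral_mono ennreal_leI le)
  finally show ?thesis unfolding h_def v_def .
qed

theorem theorem2:
  fixes P :: "'a measure"
    and A2 :: "real^'d2^'D" and V1 :: "real^'d1^'D"
    and z2 :: "'a \<Rightarrow> real^'d2" and eps2 :: "'a \<Rightarrow> real^'D"
    and p2z :: "real^'d2 \<Rightarrow> real" and p2 :: "(real^'D) measure"
    and \<sigma>2 t0 T :: real and r :: nat and \<theta> :: "nat \<Rightarrow> real"
    and g2 :: "real^'d2 \<Rightarrow> real \<Rightarrow> real^'d2"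
    and Mg2 :: "real \<Rightarrow> real^'d2^'d2" and \<mu>2 :: "real \<Rightarrow> real"
    and L M J :: nat and K \<kappa> \<gamma> \<gamma>t :: real
  assumes "0 < t0" and "t0 < T"
    and "prob_space P"
    and "transpose A2 ** A2 = mat 1"
    and "\<And>z. 0 \<le> p2z z"
    and "distributed P lborel z2 p2z"
    and "0 < \<sigma>2"
    and "distributed P lborel eps2 (iso_normal_density 0 (\<sigma>2\<^sup>2))"
    and "prob_space.indep_set P
           (sets (vimage_algebra (space P) z2 borel)) (sets (vimage_algebra (space P) eps2 borel))"
    and "p2 = distr P borel (\<lambda>\<omega>. A2 *v z2 \<omega> + eps2 \<omega>)"
    and "transpose V1 ** V1 = mat 1"
    and "r = min CARD('d1) CARD('d2)"
    and "\<And>j. j \<in> {1..r} \<Longrightarrow> 0 \<le> \<theta> j \<and> \<theta> j \<le> pi / 2"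
    and "\<And>i j. 1 \<le> i \<Longrightarrow> i \<le> j \<Longrightarrow> j \<le> r \<Longrightarrow> \<theta> i \<le> \<theta> j"
    and "\<And>j. j \<in> {1..r} \<Longrightarrow> singular_value (transpose V1 ** A2) j = cos (\<theta> j)"
    and "\<And>y t. g2 y t = hvar t *\<^sub>R gradient (\<lambda>y. ln (ld_density \<sigma>2 p2z t y)) y + y"
    and "\<And>t i j. t \<in> {t0..T} \<Longrightarrow>
           integrable (forward_law p2 t)
             (\<lambda>x. g2 (transpose A2 *v x) t $ i * g2 (transpose A2 *v x) t $ j)"
    and "\<And>t. Mg2 t =
           (\<chi> i j. \<integral>x. g2 (transpose A2 *v x) t $ i * g2 (transpose A2 *v x) t $ j
              \<partial>forward_law p2 t)"
    and "\<And>t. \<mu>2 t = lambda_min (Mg2 t)"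
  shows "let lower_bound =
           ennreal (1 / (T - t0)) *
           (\<integral>\<^sup>+t\<in>{t0..T}. ennreal
              (\<mu>2 t / (hvar t)\<^sup>2 * (real CARD('d2) - (\<Sum>j=1..r. (cos (\<theta> j))\<^sup>2))
               + \<sigma>2 ^ 4 * (alpha t) ^ 4 / ((hvar t)\<^sup>2 * htilde \<sigma>2 t)
                 * (real CARD('D) - real CARD('d1) - real CARD('d2)
                    + (\<Sum>j=1..r. (cos (\<theta> j))\<^sup>2))) \<partial>lborel)
         in lower_bound \<le> B_str p2 t0 T V1
            \<and> lower_bound \<le> B_freeze p2 t0 T V1 L M J K \<kappa> \<gamma> \<gamma>t"
proof -
  interpret prob_space P by fact
  note t0 = \<open>0 < t0\<close>
  have A: "isometry_matrix A2" and V: "isometry_matrix V1"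
    using assms by (simp_all add: isometry_matrix_def)
  have [measurable]: "z2 \<in> borel_measurable P" "eps2 \<in> borel_measurable P"
    using \<open>distributed P lborel z2 p2z\<close> \<open>distributed P lborel eps2 (iso_normal_density 0 (\<sigma>2\<^sup>2))\<close>
    by (auto simp: distributed_def)
  have [measurable]: "p2z \<in> borel_measurable borel"
    using distributed_real_measurable[OF _ \<open>distributed P lborel z2 p2z\<close>] assms(5) by simp
  have N: "prob_space (density lborel p2z)"
    unfolding distributed_distr_eq_density[OF \<open>distributed P lborel z2 p2z\<close>, symmetric]
    by (rule prob_space_distr) simp
  have [measurable]: "(\<lambda>x. A2 *v x) \<in> borel_measurable borel"
    by (intro borel_measurable_continuous_onI linear_continuous_on matrix_vector_mul_bounded_linear)
  have p2: "prob_space p2" "sets p2 = sets borel"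
    unfolding \<open>p2 = _\<close> by (auto intro: prob_space_distr)
  define \<tau> where "\<tau> = trace (transpose (transpose V1 ** A2) ** (transpose V1 ** A2))"
  \<comment> \<open>The principal angles enter only here: their cosines are the singular values of
    \<open>transpose V1 ** A2\<close>, whose squares sum to the trace.\<close>
  have \<tau>: "(\<Sum>j=1..r. (cos (\<theta> j))\<^sup>2) = \<tau>"
    unfolding \<tau>_def sum_singular_values_squared[OF \<open>r = _\<close>, symmetric]
    using assms(15) by (intro sum.cong) simp_all
  define bound where "bound t = \<mu>2 t / (hvar t)\<^sup>2 * (real CARD('d2) - \<tau>)
      + \<sigma>2 ^ 4 * (alpha t) ^ 4 / ((hvar t)\<^sup>2 * htilde \<sigma>2 t)
        * (real CARD('D) - real CARD('d1) - real CARD('d2) + \<tau>)" for t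
  have bound: "ennreal (bound t)
      \<le> (\<integral>\<^sup>+x. ennreal ((norm (structured_score V1 f x t - gradient (\<lambda>x. ln (forward_density p2 t x)) x))\<^sup>2)
          \<partial>forward_law p2 t)" if t: "t \<in> {t0..T}" for t f
  proof -
    have "0 < t" using t t0 by simp
    show ?thesis
      unfolding bound_def \<tau>_def assms(19) assms(18) assms(16)
    proof (rule score_risk_at_time_ge[OF A V N])
      show "forward_law p2 t = density lborel (forward_density p2 t)"
        by (rule forward_law_eq_density[OF p2 \<open>0 < t\<close>])
      show "ennreal (forward_density p2 t x)
        = (\<integral>\<^sup>+y. ennreal (iso_normal_density (A2 *v (alpha t *\<^sub>R y)) (htilde \<sigma>2 t) x) \<partial>density lborel p2z)" for x
        by (rule ennreal_forward_density_mixture) fact+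
      show "integrable (forward_law p2 t)
          (\<lambda>x. (hvar t *\<^sub>R gradient (\<lambda>y. ln (ld_density \<sigma>2 p2z t y)) (transpose A2 *v x) + transpose A2 *v x) $ i
             * (hvar t *\<^sub>R gradient (\<lambda>y. ln (ld_density \<sigma>2 p2z t y)) (transpose A2 *v x) + transpose A2 *v x) $ j)" for i j
        using assms(17)[OF t, of i j] unfolding assms(16) .
    qed (use \<open>0 < t\<close> assms(5) in simp_all)
  qed
  \<comment> \<open>The bound at each time is uniform in \<open>f\<close>, so it may be integrated
    over time before the infimum is taken.\<close>
  have str: "ennreal (1 / (T - t0)) * (\<integral>\<^sup>+t\<in>{t0..T}. ennreal (bound t) \<partial>lborel) \<le> B_str p2 t0 T V1"
    unfolding B_str_def
  proof (rule INF_greatest)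
    fix s assume "s \<in> structural_class V1 t0 T"
    then obtain f where "s = structured_score V1 f" by (auto simp: structural_class_def)
    then show "ennreal (1 / (T - t0)) * (\<integral>\<^sup>+t\<in>{t0..T}. ennreal (bound t) \<partial>lborel) \<le> score_risk p2 t0 T s"
      unfolding score_risk_def using bound
      by (auto intro!: mult_left_mono nn_integral_mono split: split_indicator)
  qed
  also have "B_str p2 t0 T V1 \<le> B_freeze p2 t0 T V1 L M J K \<kappa> \<gamma> \<gamma>t"
    unfolding B_str_def B_freeze_def by (intro INF_superset_mono) (auto simp: frozen_class_def)
  finally show ?thesis
    using str unfolding bound_def \<tau> Let_def by blast
qed

end
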